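(* Consider the two-source state $\rho_s$, $s=(s_1,s_2,s_3)\in\mathbb R^3$, on $L^2(\mathbb R^2)$. Let $\{\pi_\alpha\}$ be an orthonormal basis of $L^2(\mathbb R^2)$ consisting of real-valued functions each of which is either even or odd under $r\mapsto-r$. Then the projective measurement consisting of the rank-one projectors $|\pi_\alpha\rangle\langle\pi_\alpha|$ is optimal for the estimation of the transverse separation (parameters $s_1,s_2$) on the plane $s_3=0$: at every point $s_0=(s_1,s_2,0)$ and for every $\alpha$, the matrix bound of the classical Fisher information for $(s_1,s_2)$ corresponding to $\Pi=|\pi_\alpha\rangle\langle\pi_\alpha|$ is saturated at $s_0$.
   Context: State. Fix $a>0$ and $k>0$. For $s=(s_1,s_2,s_3)$, $s_\perp=(s_1,s_2)$ and $r=(x_1,x_2)\in\mathbb R^2$, let $\Phi_s(r)=\frac{1}{\sqrt\pi\,a}\,\mathrm{circ}(|r|/a)\exp[\mathrm i k(s_\perp\cdot r-s_3|r|^2/2)]$, where $\mathrm{circ}(|r|/a)=1$ if $|r|\le a$ and $0$ otherwise. The one-photon state of two incoherent point sources at $\pm s$ is $\rho_s=\tfrac12|\Phi_s\rangle\langle\Phi_s|+\tfrac12|\Phi_{-s}\rangle\langle\Phi_{-s}|$ (rank $2$ for $s\ne0$, rank $1$ at $s=0$). Write $\partial_i=\partial/\partial s_i$. Fisher information of a projector $\Pi$ for the transverse parameters. For $s\neq0$, $L_{is}$ is a bounded self-adjoint solution of $\tfrac12(L_{is}\rho_s+\rho_sL_{is})=\partial_i\rho_s$ and $\mathcal I_{ij}(s)=\operatorname{Re}\operatorname{Tr}(\rho_sL_{is}\Pi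 L_{js})$, $i,j\in\{1,2\}$. With $h(s)=\operatorname{Tr}(\rho_s\Pi)$, $\mathcal F_{ij}(s)=\partial_ih(s)\partial_jh(s)/h(s)$, $i,j\in\{1,2\}$, where $h(s)>0$. One has $\mathcal F\le\mathcal I$ as $2\times2$ matrices. Saturation at $s_0$. Directions are $v=(v_1,v_2,0)\ne0$. If $h(s_0)>0$ ($\Pi$ regular), it means $\lim_{t\to0}\mathcal F(s_0+tv)=\lim_{t\to0}\mathcal I(s_0+tv)$ for every direction $v$ (for $s_0\neq0$ this is just $\mathcal F(s_0)=\mathcal I(s_0)$). If $h(s_0)=0$ ($\Pi$ null), it means the same equality of limits for every direction $v$ with $\sum_{p,q\in\{1,2\}}\partial_p\partial_qh(s_0)v_pv_q>0$; if this $2\times2$ Hessian is zero, the limit of $\mathcal F$ is taken to be $0$ for every direction $v$. *)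

theory Defs
  imports "HOL-Analysis.Analysis"
begin

text \<open>Elements of the complex Hilbert space of square-integrable functions on the plane are
  represented by functions, to be read up to equality almost everywhere.\<close>

type_synonym wavefun = "real^2 \<Rightarrow> complex"

definition L2 :: "wavefun set" where
  "L2 = {f. f \<in> borel_measurable lborel \<and> integrable lborel (\<lambda>r. (cmod (f r))\<^sup>2)}"

definition braket :: "wavefun \<Rightarrow> wavefun \<Rightarrow> complex" where
  "braket f g = (LINT r|lborel. cnj (f r) * g r)"

definition L2_norm :: "wavefun \<Rightarrow> real" where
  "L2_norm f = sqrt (LINT r|lborel. (cmod (f r))\<^sup>2)"

definition orthonormal_basis :: "wavefun set \<Rightarrow> bool" where
  "orthonormal_basis B \<longleftrightarrow>
     B \<subseteq> L2 \<and>
     (\<forall>e\<in>B. \<forall>f\<in>B. braket e f = (if e = f then 1 else 0)) \<and>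
     (\<forall>f\<in>L2. \<forall>\<epsilon>>0. \<exists>A c. finite A \<and> A \<subseteq> B \<and>
        L2_norm (\<lambda>r. f r - (\<Sum>e\<in>A. c e * e r)) < \<epsilon>)"

type_synonym oper = "wavefun \<Rightarrow> wavefun"

text \<open>Linearity is required almost everywhere. Together with the norm bound it implies that the
  operator respects equality almost everywhere.\<close>

definition bounded_oper :: "oper \<Rightarrow> bool" where
  "bounded_oper T \<longleftrightarrow>
     (\<forall>f\<in>L2. T f \<in> L2) \<and>
     (\<forall>f\<in>L2. \<forall>g\<in>L2. \<forall>c.
        AE r in lborel. T (\<lambda>x. c * f x + g x) r = c * T f r + T g r) \<and>
     (\<exists>K. \<forall>f\<in>L2. L2_norm (T f) \<le> K * L2_norm f)"

definition selfadjoint_oper :: "oper \<Rightarrow> bool" where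
  "selfadjoint_oper T \<longleftrightarrow> (\<forall>f\<in>L2. \<forall>g\<in>L2. braket f (T g) = braket (T f) g)"

definition ketbra :: "wavefun \<Rightarrow> wavefun \<Rightarrow> oper" where
  "ketbra f g = (\<lambda>u r. f r * braket g u)"

text \<open>The trace is the common value of the diagonal sums over all orthonormal bases.\<close>

definition oper_trace :: "oper \<Rightarrow> complex" where
  "oper_trace T =
     (THE c. \<forall>B. orthonormal_basis B \<longrightarrow> ((\<lambda>e. braket e (T e)) has_sum c) B)"

text \<open>\<open>D\<close> is the derivative at \<open>0\<close>, in operator norm, of the operator-valued function \<open>T\<close>.\<close>

definition has_oper_derivative :: "(real \<Rightarrow> oper) \<Rightarrow> oper \<Rightarrow> bool" where
  "has_oper_derivative T D \<longleftrightarrow>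
     (\<forall>\<epsilon>>0. \<forall>\<^sub>F x in at 0. \<forall>f\<in>L2.
        L2_norm (\<lambda>r. (T x f r - T 0 f r) / complex_of_real x - D f r) \<le> \<epsilon> * L2_norm f)"

definition circ :: "real \<Rightarrow> real" where
  "circ u = (if u \<le> 1 then 1 else 0)"

definition Phi :: "real \<Rightarrow> real \<Rightarrow> real^3 \<Rightarrow> wavefun" where
  "Phi a k s r =
     complex_of_real (1 / (sqrt pi * a) * circ (norm r / a)) *
     exp (\<i> * complex_of_real (k * (s$1 * r$1 + s$2 * r$2 - s$3 * (norm r)\<^sup>2 / 2)))"

definition rho :: "real \<Rightarrow> real \<Rightarrow> real^3 \<Rightarrow> oper" where
  "rho a k s = (\<lambda>f r.
     1/2 * ketbra (Phi a k s) (Phi a k s) f r + 1/2 * ketbra (Phi a k (-s)) (Phi a k (-s)) f r)"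

definition transverse :: "real^2 \<Rightarrow> real^3" where
  "transverse v = vector [v$1, v$2, 0]"

definition partial :: "2 \<Rightarrow> (real^3 \<Rightarrow> real) \<Rightarrow> real^3 \<Rightarrow> real" where
  "partial i h s = deriv (\<lambda>x. h (s + x *\<^sub>R transverse (axis i 1))) 0"

text \<open>The last conjunct expresses that \<open>(rho L + L rho) / 2\<close> is the partial derivative
  of \<open>\<rho>\<close> with respect to the \<open>i\<close>-th transverse parameter.\<close>

definition is_SLD :: "real \<Rightarrow> real \<Rightarrow> real^3 \<Rightarrow> 2 \<Rightarrow> oper \<Rightarrow> bool" where
  "is_SLD a k s i L \<longleftrightarrow>
     bounded_oper L \<and> selfadjoint_oper L \<and>
     has_oper_derivative (\<lambda>x. rho a k (s + x *\<^sub>R transverse (axis i 1)))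
       (\<lambda>f r. 1/2 * (L (rho a k s f) r + rho a k s (L f) r))"

text \<open>A symmetric logarithmic derivative is not unique. The bounding matrix is the common value
  for all choices; the description below is proper only if such operators exist and the value
  does not depend on them.\<close>

definition info_bound :: "real \<Rightarrow> real \<Rightarrow> oper \<Rightarrow> real^3 \<Rightarrow> real^2^2" where
  "info_bound a k P s = (\<chi> i j. THE x. \<forall>L L'. is_SLD a k s i L \<longrightarrow> is_SLD a k s j L' \<longrightarrow>
     x = Re (oper_trace (rho a k s \<circ> L \<circ> P \<circ> L')))"

definition prob_fun :: "real \<Rightarrow> real \<Rightarrow> oper \<Rightarrow> real^3 \<Rightarrow> real" where
  "prob_fun a k P s = Re (oper_trace (rho a k s \<circ> P))"

text \<open>Only meaningful where \<open>prob_fun a k P s > 0\<close>.\<close>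

definition fisher_info :: "real \<Rightarrow> real \<Rightarrow> oper \<Rightarrow> real^3 \<Rightarrow> real^2^2" where
  "fisher_info a k P s =
     (\<chi> i j. partial i (prob_fun a k P) s * partial j (prob_fun a k P) s / prob_fun a k P s)"

definition prob_hessian :: "real \<Rightarrow> real \<Rightarrow> oper \<Rightarrow> real^3 \<Rightarrow> real^2^2" where
  "prob_hessian a k P s = (\<chi> p q. partial p (partial q (prob_fun a k P)) s)"

definition limits_agree :: "real \<Rightarrow> real \<Rightarrow> oper \<Rightarrow> real^3 \<Rightarrow> real^2 \<Rightarrow> bool" where
  "limits_agree a k P s0 v \<longleftrightarrow>
     (\<exists>M. ((\<lambda>t. fisher_info a k P (s0 + t *\<^sub>R transverse v)) \<longlongrightarrow> M) (at 0) \<and>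
          ((\<lambda>t. info_bound a k P (s0 + t *\<^sub>R transverse v)) \<longlongrightarrow> M) (at 0))"

text \<open>First branch: regular projector. Second branch: null projector, where a vanishing Hessian
  means by convention that the limit of the Fisher information is \<open>0\<close>.\<close>

definition saturated :: "real \<Rightarrow> real \<Rightarrow> oper \<Rightarrow> real^3 \<Rightarrow> bool" where
  "saturated a k P s0 \<longleftrightarrow>
     (if prob_fun a k P s0 > 0 then \<forall>v. v \<noteq> 0 \<longrightarrow> limits_agree a k P s0 v
      else
        (\<forall>v. v \<noteq> 0 \<and> (\<Sum>p\<in>UNIV. \<Sum>q\<in>UNIV. prob_hessian a k P s0 $ p $ q * v$p * v$q) > 0
           \<longrightarrow> limits_agree a k P s0 v) \<and>
        (prob_hessian a k P s0 = 0 \<longrightarrow>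
           (\<forall>v. v \<noteq> 0 \<longrightarrow>
              ((\<lambda>t. info_bound a k P (s0 + t *\<^sub>R transverse v)) \<longlongrightarrow> 0) (at 0))))"

end

theory Submission
  imports Defs
begin

text \<open>On the plane \<open>s$3 = 0\<close> the two wave functions are complex conjugates, so
  \<open>\<rho> = |C\<rangle>\<langle>C| + |S\<rangle>\<langle>S|\<close> with \<open>C\<close> (even) and \<open>S\<close> (odd) the real and imaginary parts of \<open>Phi\<close>.
  Transverse derivatives preserve these parities, hence do not mix the two levels, and every
  symmetric logarithmic derivative satisfies \<open>L C = 2 \<partial>\<^sub>iC\<close> and \<open>L S = 2 \<partial>\<^sub>iS\<close>. For a real \<open>\<pi>\<close> of definite
  parity only one level \<open>W\<close> overlaps with \<open>\<pi>\<close>: the probability is \<open>\<langle>\<pi>,W\<rangle>\<^sup>2\<close> and the bound is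
  \<open>4 \<langle>\<pi>,\<partial>\<^sub>iW\<rangle> \<langle>\<pi>,\<partial>\<^sub>jW\<rangle>\<close>, which is exactly the Fisher information of the square of a real amplitude.\<close>

section \<open>Square-integrable functions\<close>

text \<open>Both \<open>oper_trace\<close> and \<open>info_bound\<close> are definite descriptions,
  so their values are available only once existence and independence of all choices are established.
  For the trace, the given basis supplies existence and Parseval's identity supplies independence. A
  symmetric logarithmic derivative is not determined on the kernel of the state, but
  self-adjointness lets the bound be computed from its values on \<open>C\<close> and
  \<open>S\<close> alone, and these are forced. At the origin \<open>S\<close> vanishes and the
  state loses rank, so the two-level analysis breaks down there. Saturation, however, compares
  limits along punctured lines, which avoid the origin for small nonzero parameters, and continuity
  of the gradient of the amplitude identifies the limits. At a zero of the amplitude the limit of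
  the bound is twice the Hessian of the probability, which is why the convention for a vanishing
  Hessian gives the right value.\<close>

lemma L2_D:
  assumes "f \<in> L2"
  shows L2_measurable: "f \<in> borel_measurable lborel"
    and L2_integrable_square: "integrable lborel (\<lambda>r. (cmod (f r))\<^sup>2)"
  using assms by (auto simp: L2_def)

lemma integrable_cnj_mult:
  assumes f: "f \<in> L2" and g: "g \<in> L2"
  shows "integrable lborel (\<lambda>r. cnj (f r) * g r)"
proof (rule Bochner_Integration.integrable_bound)
  show "integrable lborel (\<lambda>r. (cmod (f r))\<^sup>2 + (cmod (g r))\<^sup>2)"
    using L2_integrable_square[OF f] L2_integrable_square[OF g] by simp
  have [measurable]: "f \<in> borel_measurable lborel" "g \<in> borel_measurable lborel"
    using f g by (auto dest: L2_measurable)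
  show "(\<lambda>r. cnj (f r) * g r) \<in> borel_measurable lborel"
    by (intro borel_measurable_times borel_measurable_continuous_on[of cnj] continuous_intros) auto
  show "AE r in lborel. norm (cnj (f r) * g r) \<le> norm ((cmod (f r))\<^sup>2 + (cmod (g r))\<^sup>2)"
  proof (rule AE_I2)
    fix r
    have "0 \<le> (cmod (f r) - cmod (g r))\<^sup>2" by simp
    then have "2 * (cmod (f r) * cmod (g r)) \<le> (cmod (f r))\<^sup>2 + (cmod (g r))\<^sup>2"
      by (simp add: power2_diff)
    moreover have "0 \<le> cmod (f r) * cmod (g r)" by simp
    ultimately have "cmod (f r) * cmod (g r) \<le> (cmod (f r))\<^sup>2 + (cmod (g r))\<^sup>2" by linarith
    then show "norm (cnj (f r) * g r) \<le> norm ((cmod (f r))\<^sup>2 + (cmod (g r))\<^sup>2)"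
      by (simp add: norm_mult)
  qed
qed

lemma L2_cmult [intro]:
  assumes "f \<in> L2" shows "(\<lambda>r. c * f r) \<in> L2"
  using assms by (auto simp: L2_def norm_mult power_mult_distrib)

lemma L2_add [intro]:
  assumes f: "f \<in> L2" and g: "g \<in> L2" shows "(\<lambda>r. f r + g r) \<in> L2"
proof -
  have [measurable]: "f \<in> borel_measurable lborel" "g \<in> borel_measurable lborel"
    using f g by (auto dest: L2_measurable)
  have "integrable lborel (\<lambda>r. (cmod (f r + g r))\<^sup>2)"
  proof (rule Bochner_Integration.integrable_bound)
    show "integrable lborel (\<lambda>r. 2 * (cmod (f r))\<^sup>2 + 2 * (cmod (g r))\<^sup>2)"
      using L2_integrable_square[OF f] L2_integrable_square[OF g] by simp
    show "AE r in lborel. norm ((cmod (f r + g r))\<^sup>2) \<le> norm (2 * (cmod (f r))\<^sup>2 + 2 * (cmod (g r))\<^sup>2)"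
    proof (rule AE_I2)
      fix r
      have "(cmod (f r + g r))\<^sup>2 \<le> (cmod (f r) + cmod (g r))\<^sup>2"
        by (intro power_mono norm_triangle_ineq) simp
      also have "\<dots> \<le> 2 * (cmod (f r))\<^sup>2 + 2 * (cmod (g r))\<^sup>2"
        using zero_le_power2[of "cmod (f r) - cmod (g r)"] by (simp add: power2_sum power2_diff)
      finally show "norm ((cmod (f r + g r))\<^sup>2) \<le> norm (2 * (cmod (f r))\<^sup>2 + 2 * (cmod (g r))\<^sup>2)"
        by simp
    qed
  qed simp
  then show ?thesis by (simp add: L2_def)
qed

lemma L2_zero [intro, simp]: "(\<lambda>r. 0) \<in> L2"
  by (simp add: L2_def)

lemma L2_diff [intro]:
  assumes "f \<in> L2" and "g \<in> L2" shows "(\<lambda>r. f r - g r) \<in> L2"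
  using L2_add[OF assms(1) L2_cmult[OF assms(2), of "-1"]] by simp

lemma L2_sum:
  assumes "\<And>e. e \<in> A \<Longrightarrow> F e \<in> L2" shows "(\<lambda>r. \<Sum>e\<in>A. F e r) \<in> L2"
  using assms by (induction A rule: infinite_finite_induct) auto

section \<open>Inner product, norm and the Cauchy-Schwarz inequality\<close>

lemma braket_commute: "braket g f = cnj (braket f g)"
  unfolding braket_def using Bochner_Integration.integral_cnj[of lborel "\<lambda>r. cnj (f r) * g r"] by (simp add: mult.commute)

lemma braket_cmult_right: "braket f (\<lambda>r. c * g r) = c * braket f g"
proof -
  have "braket f (\<lambda>r. c * g r) = (LINT r|lborel. c * (cnj (f r) * g r))"
    unfolding braket_def by (intro Bochner_Integration.integral_cong) (auto simp: mult_ac)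
  then show ?thesis by (simp add: braket_def)
qed

lemma braket_add_right:
  assumes "f \<in> L2" "g \<in> L2" "h \<in> L2"
  shows "braket f (\<lambda>r. g r + h r) = braket f g + braket f h"
  using integrable_cnj_mult[OF assms(1,2)] integrable_cnj_mult[OF assms(1,3)]
  by (simp add: braket_def distrib_left)

lemma braket_zero_right [simp]: "braket f (\<lambda>r. 0) = 0"
  by (simp add: braket_def)

lemma braket_diff_right:
  assumes "f \<in> L2" "g \<in> L2" "h \<in> L2"
  shows "braket f (\<lambda>r. g r - h r) = braket f g - braket f h"
  using integrable_cnj_mult[OF assms(1,2)] integrable_cnj_mult[OF assms(1,3)]
  by (simp add: braket_def right_diff_distrib)

lemma braket_sum_right:
  assumes "f \<in> L2" "\<And>e. e \<in> A \<Longrightarrow> F e \<in> L2"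
  shows "braket f (\<lambda>r. \<Sum>e\<in>A. F e r) = (\<Sum>e\<in>A. braket f (F e))"
  using assms(2)
proof (induction A rule: infinite_finite_induct)
  case (insert x A)
  then show ?case using assms(1) by (simp add: braket_add_right L2_sum)
qed auto

lemma braket_add_left:
  assumes "f \<in> L2" "g \<in> L2" "h \<in> L2"
  shows "braket (\<lambda>r. g r + h r) f = braket g f + braket h f"
  using braket_add_right[OF assms] by (metis braket_commute complex_cnj_add)

lemma braket_cmult_left: "braket (\<lambda>r. c * g r) f = cnj c * braket g f"
  by (metis braket_cmult_right braket_commute complex_cnj_mult)

lemma braket_cong_AE:
  assumes "f \<in> L2" "f' \<in> L2" "g \<in> L2" "g' \<in> L2"
    and "AE r in lborel. f r = f' r" and "AE r in lborel. g r = g' r"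
  shows "braket f g = braket f' g'"
  unfolding braket_def
proof (rule integral_cong_AE)
  show "AE r in lborel. cnj (f r) * g r = cnj (f' r) * g' r"
    using assms(5,6) by eventually_elim simp
qed (use assms(1-4) integrable_cnj_mult in \<open>blast intro: borel_measurable_integrable\<close>)+

lemma braket_self: "braket f f = complex_of_real ((L2_norm f)\<^sup>2)"
proof -
  have *: "cnj (f r) * f r = complex_of_real ((cmod (f r))\<^sup>2)" for r
    by (simp only: complex_norm_square) (simp add: mult.commute)
  show ?thesis
    by (simp only: braket_def * integral_complex_of_real L2_norm_def) (simp)
qed

lemma L2_norm_nonneg [simp]: "0 \<le> L2_norm f"
  by (simp add: L2_norm_def)

lemma L2_norm_square: "(L2_norm f)\<^sup>2 = (LINT r|lborel. (cmod (f r))\<^sup>2)"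
  by (simp add: L2_norm_def)

lemma AE_zero_if_L2_norm_zero:
  assumes "f \<in> L2" "L2_norm f = 0"
  shows "AE r in lborel. f r = 0"
proof -
  have "(LINT r|lborel. (cmod (f r))\<^sup>2) = 0"
    using assms(2) L2_norm_square[of f] by simp
  then have "AE r in lborel. (cmod (f r))\<^sup>2 = 0"
    using integral_nonneg_eq_0_iff_AE[OF L2_integrable_square[OF assms(1)]] by simp
  then show ?thesis by simp
qed

text \<open>The discriminant argument is run for the integral \<open>I\<close> of the product of the
  moduli. It dominates the modulus of the bracket, so no phase has to be chosen. The value of
  \<open>t\<close> inserted into \<open>quad\<close> is the one that minimises its right side
  divided by \<open>t\<close>.\<close>

lemma L2_Cauchy_Schwarz:
  assumes f: "f \<in> L2" and g: "g \<in> L2"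
  shows "cmod (braket f g) \<le> L2_norm f * L2_norm g"
proof -
  have int: "integrable lborel (\<lambda>r. cmod (f r) * cmod (g r))"
    using integrable_norm[OF integrable_cnj_mult[OF f g]] by (simp add: norm_mult)
  define I where "I = (LINT r|lborel. cmod (f r) * cmod (g r))"
  have le_I: "cmod (braket f g) \<le> I"
    using integral_norm_bound[of lborel "\<lambda>r. cnj (f r) * g r"]
    unfolding braket_def I_def by (simp add: norm_mult)
  have quad: "2 * I * t \<le> (L2_norm f)\<^sup>2 * t\<^sup>2 + (L2_norm g)\<^sup>2" for t
  proof -
    have "(LINT r|lborel. 2 * t * (cmod (f r) * cmod (g r))) \<le>
      (LINT r|lborel. t\<^sup>2 * (cmod (f r))\<^sup>2 + (cmod (g r))\<^sup>2)"
    proof (rule integral_mono)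
      fix r
      have "0 \<le> (t * cmod (f r) - cmod (g r))\<^sup>2" by simp
      then show "2 * t * (cmod (f r) * cmod (g r)) \<le> t\<^sup>2 * (cmod (f r))\<^sup>2 + (cmod (g r))\<^sup>2"
        by (simp add: power2_diff power_mult_distrib mult_ac)
    qed (use int L2_integrable_square[OF f] L2_integrable_square[OF g] in auto)
    then show ?thesis
      using L2_integrable_square[OF f] L2_integrable_square[OF g]
      by (simp add: I_def L2_norm_square mult_ac)
  qed
  show ?thesis
  proof (cases "L2_norm f = 0")
    case True
    have "braket f g = braket (\<lambda>r. 0) g"
      using AE_zero_if_L2_norm_zero[OF f True] f g by (intro braket_cong_AE) auto
    then show ?thesis by (simp add: braket_def True)
  next
    case False
    then have pos: "L2_norm f > 0" by (simp add: order_less_le)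
    have "2 * I * (L2_norm g / L2_norm f) \<le> 2 * (L2_norm g)\<^sup>2"
      using quad[of "L2_norm g / L2_norm f"] pos by (simp add: power_divide)
    then have le: "I * L2_norm g \<le> L2_norm f * L2_norm g * L2_norm g"
      using pos by (simp add: field_simps power2_eq_square)
    show ?thesis
    proof (cases "L2_norm g = 0")
      case True
      have "braket f g = braket f (\<lambda>r. 0)"
        using AE_zero_if_L2_norm_zero[OF g True] f g by (intro braket_cong_AE) auto
      then show ?thesis by (simp add: True)
    next
      case False
      then have "L2_norm g > 0" by (simp add: order_less_le)
      then have "I \<le> L2_norm f * L2_norm g" using le by simp
      then show ?thesis using le_I by linarith
    qed
  qed
qed

lemma L2_norm_mono:
  assumes "g \<in> L2" "f \<in> borel_measurable lborel" "\<And>r. cmod (f r) \<le> cmod (g r)"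
  shows "L2_norm f \<le> L2_norm g"
proof -
  have sq: "(cmod (f r))\<^sup>2 \<le> (cmod (g r))\<^sup>2" for r
    using assms(3) by (intro power_mono) auto
  have "integrable lborel (\<lambda>r. (cmod (f r))\<^sup>2)"
    by (rule Bochner_Integration.integrable_bound[OF L2_integrable_square[OF assms(1)]])
       (use assms(2) sq in auto)
  then show ?thesis
    unfolding L2_norm_def using sq L2_integrable_square[OF assms(1)]
    by (intro real_sqrt_le_mono integral_mono) auto
qed

lemma L2_norm_cmult: "L2_norm (\<lambda>r. c * f r) = cmod c * L2_norm f"
  by (simp add: L2_norm_def norm_mult power_mult_distrib real_sqrt_mult)

lemma L2_norm_triangle:
  assumes f: "f \<in> L2" and g: "g \<in> L2"
  shows "L2_norm (\<lambda>r. f r + g r) \<le> L2_norm f + L2_norm g"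
proof -
  have "complex_of_real ((L2_norm (\<lambda>r. f r + g r))\<^sup>2) =
      braket f f + braket f g + (braket g f + braket g g)"
    using f g L2_add[OF f g] by (simp only: braket_add_left braket_add_right flip: braket_self)
  then have "(L2_norm (\<lambda>r. f r + g r))\<^sup>2 = Re (braket f f + braket f g + (braket g f + braket g g))"
    by (metis Re_complex_of_real)
  also have "\<dots> = (L2_norm f)\<^sup>2 + (L2_norm g)\<^sup>2 + 2 * Re (braket f g)"
    by (simp add: braket_self braket_commute[of g f])
  also have "\<dots> \<le> (L2_norm f)\<^sup>2 + (L2_norm g)\<^sup>2 + 2 * (L2_norm f * L2_norm g)"
    using L2_Cauchy_Schwarz[OF f g] complex_Re_le_cmod[of "braket f g"] by linarith
  also have "\<dots> = (L2_norm f + L2_norm g)\<^sup>2" by (simp add: power2_sum)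
  finally show ?thesis by (rule power2_le_imp_le) simp
qed

text \<open>The residual of the orthogonal projection onto a finite set of basis vectors is
  dominated by the residual of any linear combination of a subset of them. This turns the
  density condition into convergence along the net of finite subsets.\<close>

lemma orthonormal_basis_Parseval:
  assumes B: "orthonormal_basis B" and w: "w \<in> L2" and u: "u \<in> L2"
  shows "((\<lambda>e. braket w e * braket e u) has_sum braket w u) B"
  unfolding has_sum_def tendsto_iff eventually_finite_subsets_at_top
proof (intro allI impI)
  fix \<epsilon> :: real assume "\<epsilon> > 0"
  \<comment> \<open>Adding 1 keeps the denominator positive when \<open>w\<close> has norm
    zero.\<close>
  define \<delta> where "\<delta> = \<epsilon> / (L2_norm w + 1)"
  have wpos: "L2_norm w + 1 > 0" using L2_norm_nonneg[of w] by linarith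
  have "\<delta> > 0" using \<open>\<epsilon> > 0\<close> wpos by (simp add: \<delta>_def)
  then obtain A c where A: "finite A" "A \<subseteq> B" and approx: "L2_norm (\<lambda>r. u r - (\<Sum>e\<in>A. c e * e r)) < \<delta>"
    using B u unfolding orthonormal_basis_def by meson
  have BL2: "e \<in> L2" if "e \<in> B" for e using B that by (auto simp: orthonormal_basis_def)
  have orth: "braket e f = (if e = f then 1 else 0)" if "e \<in> B" "f \<in> B" for e f
    using B that by (auto simp: orthonormal_basis_def)
  show "\<exists>F0. finite F0 \<and> F0 \<subseteq> B \<and> (\<forall>F. finite F \<and> F \<supseteq> F0 \<and> F \<subseteq> B \<longrightarrow>
      dist (\<Sum>e\<in>F. braket w e * braket e u) (braket w u) < \<epsilon>)"
  proof (intro exI[of _ A] conjI A allI impI)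
    fix F assume F: "finite F \<and> A \<subseteq> F \<and> F \<subseteq> B"
    define y where "y = (\<lambda>r. \<Sum>e\<in>A. c e * e r)"
    define p where "p = (\<lambda>r. \<Sum>e\<in>F. braket e u * e r)"
    define q where "q = (\<lambda>r. u r - p r)"
    have yL: "y \<in> L2" unfolding y_def using A BL2 by (intro L2_sum L2_cmult) auto
    have pL: "p \<in> L2" unfolding p_def using F BL2 by (intro L2_sum L2_cmult) auto
    have qL: "q \<in> L2" unfolding q_def using u pL by (rule L2_diff)
    have qe: "braket e q = 0" if e: "e \<in> F" for e
    proof -
      have eB: "e \<in> B" using e F by auto
      have "braket e p = (\<Sum>f\<in>F. braket f u * braket e f)"
        unfolding p_def using F BL2 eB by (subst braket_sum_right) (auto simp: braket_cmult_right)
      also have "\<dots> = (\<Sum>f\<in>F. if f = e then braket f u else 0)"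
        using F eB by (intro sum.cong) (auto simp: orth)
      also have "\<dots> = braket e u" using F e by simp
      finally show ?thesis
        unfolding q_def using BL2[OF eB] u pL by (simp add: braket_diff_right)
    qed
    then have eq: "braket q e = 0" if "e \<in> F" for e
      using that by (metis braket_commute complex_cnj_zero)
    have qp: "braket q p = 0"
      unfolding p_def using F BL2 qL
      by (subst braket_sum_right) (auto intro!: L2_cmult sum.neutral simp: braket_cmult_right eq)
    have qy: "braket q y = 0"
      unfolding y_def using A F BL2 qL
      by (subst braket_sum_right)
        (auto intro!: L2_cmult sum.neutral simp: braket_cmult_right eq subset_iff)
    \<comment> \<open>The residual \<open>q\<close> is orthogonal to the projection \<open>p\<close>
      and to the competitor \<open>y\<close>, so inside \<open>braket q _\<close> the vector
      \<open>q\<close> may be replaced by \<open>u - y\<close>. Cauchy-Schwarz then makes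
      \<open>q\<close> the shorter of the two.\<close>
    have "braket q q = braket q (\<lambda>r. u r - y r)"
      using qp qy qL u yL pL by (simp add: q_def braket_diff_right)
    then have "(L2_norm q)\<^sup>2 = cmod (braket q (\<lambda>r. u r - y r))"
      using braket_self[of q] by (metis abs_of_nonneg norm_of_real zero_le_power2)
    also have "\<dots> \<le> L2_norm q * L2_norm (\<lambda>r. u r - y r)"
      using qL u yL by (intro L2_Cauchy_Schwarz) auto
    finally have le: "L2_norm q * L2_norm q \<le> L2_norm q * L2_norm (\<lambda>r. u r - y r)"
      by (simp add: power2_eq_square)
    have "L2_norm q \<le> L2_norm (\<lambda>r. u r - y r)"
    proof (cases "L2_norm q = 0")
      case False
      then have "L2_norm q > 0" by (simp add: order_less_le)
      then show ?thesis using le by simp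
    qed simp
    then have qd: "L2_norm q < \<delta>" using approx by (simp add: y_def)
    have "braket w p = (\<Sum>e\<in>F. braket e u * braket w e)"
      unfolding p_def using F BL2 w by (subst braket_sum_right) (auto simp: braket_cmult_right)
    also have "\<dots> = (\<Sum>e\<in>F. braket w e * braket e u)" by (simp add: mult.commute)
    finally have "braket w p = (\<Sum>e\<in>F. braket w e * braket e u)" .
    then have "dist (\<Sum>e\<in>F. braket w e * braket e u) (braket w u) = cmod (braket w q)"
      unfolding q_def using w u pL by (simp add: braket_diff_right dist_norm norm_minus_commute)
    also have "\<dots> \<le> L2_norm w * L2_norm q" using w qL by (rule L2_Cauchy_Schwarz)
    also have "\<dots> \<le> L2_norm w * \<delta>" using qd by (intro mult_left_mono) auto
    also have "\<dots> < (L2_norm w + 1) * \<delta>" using \<open>\<delta> > 0\<close> by simp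
    also have "\<dots> = \<epsilon>" using wpos by (simp add: \<delta>_def)
    finally show "dist (\<Sum>e\<in>F. braket w e * braket e u) (braket w u) < \<epsilon>" .
  qed
qed

section \<open>Traces of rank-one operators\<close>

text \<open>Parseval's identity gives the same diagonal sum in every basis. The basis
  \<open>B\<close> guarantees that the description is not vacuous: without any basis every number
  would satisfy it. Assuming only the diagonal elements avoids identifying \<open>T\<close>
  pointwise.\<close>

lemma oper_trace_rank_one:
  assumes B: "orthonormal_basis B" and w: "w \<in> L2" and u: "u \<in> L2"
    and T: "\<And>e. e \<in> L2 \<Longrightarrow> braket e (T e) = braket w e * braket e u"
  shows "oper_trace T = braket w u"
proof -
  have sum: "((\<lambda>e. braket e (T e)) has_sum braket w u) B'" if B': "orthonormal_basis B'" for B'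
  proof -
    have "e \<in> L2" if "e \<in> B'" for e using B' that by (auto simp: orthonormal_basis_def)
    then show ?thesis
      using has_sum_cong[of B' "\<lambda>e. braket e (T e)" "\<lambda>e. braket w e * braket e u"] T
        orthonormal_basis_Parseval[OF B' w u] by auto
  qed
  show ?thesis
    unfolding oper_trace_def
  proof (rule the_equality)
    show "\<forall>B. orthonormal_basis B \<longrightarrow> ((\<lambda>e. braket e (T e)) has_sum braket w u) B"
      using sum by blast
  next
    fix c assume "\<forall>B. orthonormal_basis B \<longrightarrow> ((\<lambda>e. braket e (T e)) has_sum c) B"
    then show "c = braket w u" using sum[OF B] B has_sum_unique by blast
  qed
qed

section \<open>Operators and symmetric logarithmic derivatives\<close>

lemma bounded_operD:
  assumes "bounded_oper T" "f \<in> L2"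
  shows bounded_oper_L2: "T f \<in> L2"
    and bounded_oper_zero: "AE r in lborel. T (\<lambda>x. 0) r = 0"
    and bounded_oper_cmult: "AE r in lborel. T (\<lambda>x. c * f x) r = c * T f r"
proof -
  show "T f \<in> L2" using assms by (auto simp: bounded_oper_def)
  have lin: "AE r in lborel. T (\<lambda>x. c * f x + g x) r = c * T f r + T g r"
    if "f \<in> L2" "g \<in> L2" for f g c
    using assms(1) that by (auto simp: bounded_oper_def)
  \<comment> \<open>With both functions zero and coefficient 1, additivity says that
    \<open>T 0\<close> equals twice itself almost everywhere.\<close>
  have "AE r in lborel. T (\<lambda>x. 1 * 0 + 0) r = 1 * T (\<lambda>x. 0) r + T (\<lambda>x. 0) r"
    by (rule lin) auto
  then show zero: "AE r in lborel. T (\<lambda>x. 0) r = 0"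
    by simp
  have "AE r in lborel. T (\<lambda>x. c * f x + 0) r = c * T f r + T (\<lambda>x. 0) r"
    by (rule lin) (use assms in auto)
  with zero show "AE r in lborel. T (\<lambda>x. c * f x) r = c * T f r"
    by eventually_elim simp
qed

lemma L2_ketbra: "f \<in> L2 \<Longrightarrow> ketbra f g u \<in> L2"
  unfolding ketbra_def using L2_cmult[of f "braket g u"] by (simp add: mult.commute)

lemma braket_ketbra_right: "braket h (ketbra f g u) = braket h f * braket g u"
  unfolding ketbra_def using braket_cmult_right[of h "braket g u" f] by (simp add: mult.commute)

lemma bounded_oper_ketbra:
  assumes "f \<in> L2" "g \<in> L2"
  shows "bounded_oper (ketbra f g)"
  unfolding bounded_oper_def
proof (intro conjI ballI allI)
  fix u assume "u \<in> L2"
  then show "ketbra f g u \<in> L2" using assms by (intro L2_ketbra)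
next
  fix u v c assume "u \<in> L2" "v \<in> L2"
  then have "braket g (\<lambda>x. c * u x + v x) = c * braket g u + braket g v"
    using assms by (simp add: braket_add_right L2_cmult braket_cmult_right)
  then show "AE r in lborel. ketbra f g (\<lambda>x. c * u x + v x) r = c * ketbra f g u r + ketbra f g v r"
    by (simp add: ketbra_def algebra_simps)
next
  show "\<exists>K. \<forall>u\<in>L2. L2_norm (ketbra f g u) \<le> K * L2_norm u"
  proof (intro exI ballI)
    fix u assume "u \<in> L2"
    then have "cmod (braket g u) * L2_norm f \<le> L2_norm g * L2_norm u * L2_norm f"
      using L2_Cauchy_Schwarz[of g u] assms by (intro mult_right_mono) auto
    then show "L2_norm (ketbra f g u) \<le> (L2_norm f * L2_norm g) * L2_norm u"
      unfolding ketbra_def using L2_norm_cmult[of "braket g u" f] by (simp add: mult_ac)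
  qed
qed

lemma bounded_oper_add:
  assumes "bounded_oper S" "bounded_oper T"
  shows "bounded_oper (\<lambda>f r. S f r + T f r)"
  unfolding bounded_oper_def
proof (intro conjI ballI allI)
  fix f assume f: "f \<in> L2"
  then show "(\<lambda>r. S f r + T f r) \<in> L2" by (intro L2_add assms[THEN bounded_oper_L2])
next
  fix f g c assume "f \<in> L2" "g \<in> L2"
  then have "AE r in lborel. S (\<lambda>x. c * f x + g x) r = c * S f r + S g r"
    "AE r in lborel. T (\<lambda>x. c * f x + g x) r = c * T f r + T g r"
    using assms by (auto simp: bounded_oper_def)
  then show "AE r in lborel. S (\<lambda>x. c * f x + g x) r + T (\<lambda>x. c * f x + g x) r =
      c * (S f r + T f r) + (S g r + T g r)"
    by eventually_elim (simp add: algebra_simps)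
next
  obtain K K' where K: "\<And>f. f \<in> L2 \<Longrightarrow> L2_norm (S f) \<le> K * L2_norm f"
    "\<And>f. f \<in> L2 \<Longrightarrow> L2_norm (T f) \<le> K' * L2_norm f"
    using assms unfolding bounded_oper_def by metis
  have "L2_norm (\<lambda>r. S f r + T f r) \<le> (K + K') * L2_norm f" if "f \<in> L2" for f
    using L2_norm_triangle[OF bounded_oper_L2[OF assms(1) that] bounded_oper_L2[OF assms(2) that]]
      K[OF that] by (simp add: distrib_right)
  then show "\<exists>K. \<forall>f\<in>L2. L2_norm (\<lambda>r. S f r + T f r) \<le> K * L2_norm f" by blast
qed

lemma bounded_oper_scale:
  assumes "bounded_oper T"
  shows "bounded_oper (\<lambda>f r. a * T f r)"
  unfolding bounded_oper_def
proof (intro conjI ballI allI)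
  fix f assume f: "f \<in> L2"
  then show "(\<lambda>r. a * T f r) \<in> L2" by (intro L2_cmult assms[THEN bounded_oper_L2])
next
  fix f g c assume "f \<in> L2" "g \<in> L2"
  then have "AE r in lborel. T (\<lambda>x. c * f x + g x) r = c * T f r + T g r"
    using assms by (auto simp: bounded_oper_def)
  then show "AE r in lborel. a * T (\<lambda>x. c * f x + g x) r = c * (a * T f r) + a * T g r"
    by eventually_elim (simp add: algebra_simps)
next
  obtain K where K: "\<And>f. f \<in> L2 \<Longrightarrow> L2_norm (T f) \<le> K * L2_norm f"
    using assms unfolding bounded_oper_def by metis
  have "L2_norm (\<lambda>r. a * T f r) \<le> (cmod a * K) * L2_norm f" if "f \<in> L2" for f
    using mult_left_mono[OF K[OF that] norm_ge_zero[of a]] by (simp add: L2_norm_cmult mult_ac)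
  then show "\<exists>K. \<forall>f\<in>L2. L2_norm (\<lambda>r. a * T f r) \<le> K * L2_norm f" by blast
qed

lemma selfadjoint_oper_add:
  assumes "bounded_oper S" "bounded_oper T" "selfadjoint_oper S" "selfadjoint_oper T"
  shows "selfadjoint_oper (\<lambda>f r. S f r + T f r)"
  using assms(3,4) unfolding selfadjoint_oper_def
  by (simp add: braket_add_right braket_add_left assms(1,2)[THEN bounded_oper_L2])

lemma selfadjoint_oper_scale:
  assumes "selfadjoint_oper T" "cnj a = a"
  shows "selfadjoint_oper (\<lambda>f r. a * T f r)"
  using assms unfolding selfadjoint_oper_def by (simp add: braket_cmult_right braket_cmult_left)

lemma selfadjoint_oper_ketbra_sym:
  assumes "f \<in> L2" "g \<in> L2"
  shows "selfadjoint_oper (\<lambda>u r. ketbra f g u r + ketbra g f u r)"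
  unfolding selfadjoint_oper_def
proof (intro ballI)
  have left: "braket (ketbra f g u) v = braket u g * braket f v" for f g u v
    using braket_ketbra_right[of v f g u] by (metis braket_commute complex_cnj_mult mult.commute)
  fix u v assume "u \<in> L2" "v \<in> L2"
  then show "braket u (\<lambda>r. ketbra f g v r + ketbra g f v r) = braket (\<lambda>r. ketbra f g u r + ketbra g f u r) v"
    using assms by (simp add: braket_add_right braket_add_left L2_ketbra braket_ketbra_right left)
qed

text \<open>Converts the operator-norm condition in \<open>is_SLD\<close> into an equation between
  functions. Both candidates are within \<open>\<epsilon> * L2_norm f\<close> of a common difference
  quotient, so their difference has norm zero.\<close>

lemma has_oper_derivative_unique_AE:
  assumes D: "has_oper_derivative T D" and D': "has_oper_derivative T D'"
    and f: "f \<in> L2" and "D f \<in> L2" "D' f \<in> L2" and T: "\<And>x. T x f \<in> L2"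
  shows "AE r in lborel. D f r = D' f r"
proof -
  have small: "L2_norm (\<lambda>r. D f r - D' f r) \<le> \<epsilon> * (2 * L2_norm f)" if "\<epsilon> > 0" for \<epsilon>
  proof -
    have "\<forall>\<^sub>F x in at 0.
        L2_norm (\<lambda>r. (T x f r - T 0 f r) / complex_of_real x - D f r) \<le> \<epsilon> * L2_norm f \<and>
        L2_norm (\<lambda>r. (T x f r - T 0 f r) / complex_of_real x - D' f r) \<le> \<epsilon> * L2_norm f"
      using D D' f \<open>\<epsilon> > 0\<close> unfolding has_oper_derivative_def
      by (intro eventually_conj) (auto elim!: eventually_mono)
    then obtain x where
      x: "L2_norm (\<lambda>r. (T x f r - T 0 f r) / complex_of_real x - D f r) \<le> \<epsilon> * L2_norm f"
        "L2_norm (\<lambda>r. (T x f r - T 0 f r) / complex_of_real x - D' f r) \<le> \<epsilon> * L2_norm f"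
      using eventually_happens[of _ "at (0::real)"] by force
    define q where "q = (\<lambda>r. (T x f r - T 0 f r) / complex_of_real x)"
    have qL: "q \<in> L2"
      using L2_cmult[OF L2_diff[OF T[of x] T[of 0]], of "1 / complex_of_real x"] by (simp add: q_def)
    have "L2_norm (\<lambda>r. (q r - D' f r) + (-1) * (q r - D f r)) \<le>
        L2_norm (\<lambda>r. q r - D' f r) + L2_norm (\<lambda>r. (-1) * (q r - D f r))"
      using qL assms by (intro L2_norm_triangle L2_cmult L2_diff)
    also have "\<dots> \<le> \<epsilon> * (2 * L2_norm f)"
      unfolding L2_norm_cmult using x by (simp add: q_def)
    finally show ?thesis by simp
  qed
  have "L2_norm (\<lambda>r. D f r - D' f r) \<le> 0"
  proof (rule field_le_epsilon)
    fix e :: real assume "e > 0"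
    have p: "2 * L2_norm f + 1 > 0" using L2_norm_nonneg[of f] by linarith
    have "L2_norm (\<lambda>r. D f r - D' f r) \<le> e / (2 * L2_norm f + 1) * (2 * L2_norm f)"
      using small[of "e / (2 * L2_norm f + 1)"] \<open>e > 0\<close> p by simp
    also have "\<dots> \<le> e" using \<open>e > 0\<close> p by (simp add: field_simps)
    finally show "L2_norm (\<lambda>r. D f r - D' f r) \<le> 0 + e" by simp
  qed
  then have "L2_norm (\<lambda>r. D f r - D' f r) = 0" by (simp add: order_antisym)
  then show ?thesis
    using AE_zero_if_L2_norm_zero[of "\<lambda>r. D f r - D' f r"] assms by auto
qed

text \<open>\<open>c1\<close> and \<open>c2\<close> are unnormalised orthogonal eigenvectors of the state, \<open>d1\<close> and \<open>d2\<close> their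
  derivatives.\<close>

locale two_level =
  fixes R :: oper and c1 c2 d1 d2 :: wavefun
  assumes in_L2: "c1 \<in> L2" "c2 \<in> L2" "d1 \<in> L2" "d2 \<in> L2"
    and R_eq: "\<And>f. f \<in> L2 \<Longrightarrow> R f = (\<lambda>r. ketbra c1 c1 f r + ketbra c2 c2 f r)"
    and orth: "braket c1 c2 = 0" "braket c1 d2 = 0" "braket c2 d1 = 0"
    and real: "braket c1 d1 \<in> \<real>" "braket c2 d2 \<in> \<real>"
    and norm_nz: "L2_norm c1 \<noteq> 0" "L2_norm c2 \<noteq> 0"
begin

text \<open>The product rule applied to the sum of the two projections.\<close>

definition tangent :: oper where
  "tangent f = (\<lambda>r. (ketbra d1 c1 f r + ketbra c1 d1 f r) + (ketbra d2 c2 f r + ketbra c2 d2 f r))"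

definition SLD :: "oper \<Rightarrow> bool" where
  "SLD L \<longleftrightarrow> bounded_oper L \<and> selfadjoint_oper L \<and>
     (\<forall>f\<in>L2. AE r in lborel. 1/2 * (L (R f) r + R (L f) r) = tangent f r)"

lemma orth': "braket c2 c1 = 0" "braket d2 c1 = 0" "braket d1 c2 = 0"
  "braket d1 c1 = braket c1 d1" "braket d2 c2 = braket c2 d2"
  using orth real by (simp_all add: braket_commute[of c2 c1] braket_commute[of d2 c1]
      braket_commute[of d1 c2] braket_commute[of d1 c1] braket_commute[of d2 c2] Reals_cnj_iff)

lemma L2_tangent: "tangent f \<in> L2"
  unfolding tangent_def using in_L2 by (intro L2_add L2_ketbra)

lemma L2_R: "f \<in> L2 \<Longrightarrow> R f \<in> L2"
  unfolding R_eq using in_L2 by (intro L2_add L2_ketbra)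

lemma braket_R:
  assumes "h \<in> L2" "f \<in> L2"
  shows "braket h (R f) = braket h c1 * braket c1 f + braket h c2 * braket c2 f"
  unfolding R_eq[OF assms(2)] using assms in_L2
  by (simp add: braket_add_right L2_ketbra braket_ketbra_right)

text \<open>The equation holds as an identity of functions and not just almost everywhere, so the
  product can directly take the place of \<open>tangent\<close> in a derivative statement.\<close>

lemma SLD_exists:
  "\<exists>L. bounded_oper L \<and> selfadjoint_oper L \<and>
     (\<forall>f\<in>L2. (\<lambda>r. 1/2 * (L (R f) r + R (L f) r)) = tangent f)"
proof -
  \<comment> \<open>The first summand sends \<open>c\<close> to \<open>2 d\<close> plus a multiple
    of \<open>c\<close>, and the second cancels that multiple; hence \<open>lev c d c = 2 d\<close>
    for real \<open>braket c d\<close>. The repeated \<open>ketbra c c\<close> is a symmetric pair,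
    so one self-adjointness lemma serves both summands.\<close>
  define lev :: "wavefun \<Rightarrow> wavefun \<Rightarrow> oper" where
    "lev c d = (\<lambda>f r. 2 / braket c c * (ketbra d c f r + ketbra c d f r) +
       - (braket c d / (braket c c)\<^sup>2) * (ketbra c c f r + ketbra c c f r))" for c d
  have lev: "bounded_oper (lev c d)" "selfadjoint_oper (lev c d)"
    if "c \<in> L2" "d \<in> L2" "braket c d \<in> \<real>" for c d
    unfolding lev_def using that
    by (intro bounded_oper_add bounded_oper_scale bounded_oper_ketbra selfadjoint_oper_add
        selfadjoint_oper_scale selfadjoint_oper_ketbra_sym; simp add: braket_self Reals_cnj_iff)+
  define L where "L = (\<lambda>f r. lev c1 d1 f r + lev c2 d2 f r)"
  have bL: "bounded_oper L" and sL: "selfadjoint_oper L"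
    unfolding L_def using in_L2 real by (intro bounded_oper_add selfadjoint_oper_add lev; simp)+
  have n: "braket c1 c1 \<noteq> 0" "braket c2 c2 \<noteq> 0" using norm_nz by (auto simp: braket_self)
  have "(\<lambda>r. 1/2 * (L (R f) r + R (L f) r)) = tangent f" if f: "f \<in> L2" for f
  proof
    fix r
    have brlev: "braket h (lev c d f) = 2 / braket c c * (braket h d * braket c f + braket h c * braket d f) +
       - (braket c d / (braket c c)\<^sup>2) * (braket h c * braket c f + braket h c * braket c f)"
      if "h \<in> L2" "c \<in> L2" "d \<in> L2" for h c d
      unfolding lev_def using that
      by (simp only: braket_add_right L2_add L2_cmult L2_ketbra braket_cmult_right braket_ketbra_right)
    have "lev c d f \<in> L2" if "c \<in> L2" "d \<in> L2" for c d
      unfolding lev_def using that by (intro L2_add L2_cmult L2_ketbra)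
    then have brL: "braket h (L f) = braket h (lev c1 d1 f) + braket h (lev c2 d2 f)" if "h \<in> L2" for h
      unfolding L_def using that in_L2 by (intro braket_add_right) auto
    have c1L: "braket c1 (L f) = 2 * braket d1 f" "braket c2 (L f) = 2 * braket d2 f"
      using in_L2 n by (simp_all add: brL brlev orth orth' field_simps power2_eq_square)
    have RL: "R (L f) r = 2 * (ketbra c1 d1 f r + ketbra c2 d2 f r)"
      using bounded_oper_L2[OF bL f] by (simp add: R_eq ketbra_def c1L algebra_simps)
    have LR: "L (R f) r = 2 * (ketbra d1 c1 f r + ketbra d2 c2 f r)"
      using in_L2 n f by (simp add: L_def lev_def ketbra_def braket_R orth orth' field_simps power2_eq_square)
    show "1/2 * (L (R f) r + R (L f) r) = tangent f r"
      unfolding RL LR tangent_def by (simp add: algebra_simps)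
  qed
  then show ?thesis using bL sL by blast
qed

text \<open>At \<open>c1\<close> the defining equation expresses \<open>L c1\<close> through
  \<open>d1\<close>, \<open>c1\<close>, \<open>c2\<close> and the unknown coefficients
  \<open>p\<close>, \<open>q\<close> of \<open>R (L c1)\<close>. Pairing with \<open>c2\<close>
  leaves \<open>q * (n1 + n2) = 0\<close>, pairing with \<open>c1\<close> gives
  \<open>p = 2 * m1\<close>, and both corrections disappear. Besides \<open>n1\<close>, only the sum
  of the weights is divided by, never their difference, so coinciding eigenvalues are
  covered.\<close>

lemma SLD_c1:
  assumes "SLD L"
  shows "AE r in lborel. L c1 r = 2 * d1 r"
proof -
  note L = assms[unfolded SLD_def]
  define n1 n2 m1 p q where "n1 = braket c1 c1" and "n2 = braket c2 c2" and "m1 = braket c1 d1"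
    and "p = braket c1 (L c1)" and "q = braket c2 (L c1)"
  have Lc1: "L c1 \<in> L2" using L in_L2 by (intro bounded_oper_L2[of L c1]) auto
  have nz: "n1 \<noteq> 0" "n1 + n2 \<noteq> 0"
  proof -
    have "(L2_norm c1)\<^sup>2 > 0" "(L2_norm c2)\<^sup>2 > 0" using norm_nz by auto
    then have "(L2_norm c1)\<^sup>2 \<noteq> 0" "(L2_norm c1)\<^sup>2 + (L2_norm c2)\<^sup>2 \<noteq> 0" by linarith+
    then show "n1 \<noteq> 0" "n1 + n2 \<noteq> 0"
      unfolding n1_def n2_def braket_self of_real_add[symmetric] of_real_eq_0_iff .
  qed
  define g where "g = (\<lambda>r. 2 * d1 r + ((2 * m1 - p) / n1) * c1 r + (- q / n1) * c2 r)"
  have gL: "g \<in> L2" unfolding g_def using in_L2 by (intro L2_add L2_cmult)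
  have Rc1: "R c1 = (\<lambda>r. n1 * c1 r)"
    using in_L2 by (simp add: R_eq ketbra_def n1_def orth' mult.commute)
  have "AE r in lborel. 1/2 * (L (R c1) r + R (L c1) r) = tangent c1 r"
    using L in_L2 by blast
  moreover have "AE r in lborel. L (\<lambda>r. n1 * c1 r) r = n1 * L c1 r"
    using L in_L2 by (intro bounded_oper_cmult) auto
  ultimately have AEg: "AE r in lborel. L c1 r = g r"
  proof eventually_elim
    fix r assume 1: "1/2 * (L (R c1) r + R (L c1) r) = tangent c1 r"
      and 2: "L (\<lambda>r. n1 * c1 r) r = n1 * L c1 r"
    have 3: "R (L c1) r = c1 r * p + c2 r * q"
      using R_eq[OF Lc1] by (simp add: ketbra_def p_def q_def)
    have 4: "tangent c1 r = d1 r * n1 + c1 r * m1"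
      by (simp add: tangent_def ketbra_def orth' n1_def m1_def)
    have "n1 * L c1 r = 2 * (d1 r * n1 + c1 r * m1) - (c1 r * p + c2 r * q)"
    proof -
      have "L (R c1) r + R (L c1) r = 2 * tangent c1 r" using 1 by simp
      then show ?thesis unfolding Rc1 2 3 4 by (simp add: algebra_simps)
    qed
    also have "\<dots> = n1 * g r"
      using nz(1) unfolding g_def by (simp add: field_simps)
    finally show "L c1 r = g r" using nz(1) by simp
  qed
  have brg: "braket h (L c1) = 2 * braket h d1 + ((2 * m1 - p) / n1) * braket h c1 + (- q / n1) * braket h c2"
    if "h \<in> L2" for h
  proof -
    have "braket h (L c1) = braket h g"
      using that Lc1 gL AEg by (intro braket_cong_AE) auto
    then show ?thesis
      unfolding g_def using that in_L2
      by (simp only: braket_add_right L2_add L2_cmult braket_cmult_right)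
  qed
  have "q * (n1 + n2) = 0"
    using brg[OF in_L2(2)] nz(1) unfolding q_def[symmetric] n2_def[symmetric]
    by (simp add: orth orth' field_simps)
  then have q: "q = 0" using nz by simp
  have "p = 2 * m1"
    using brg[OF in_L2(1)] nz(1) unfolding p_def[symmetric] n1_def[symmetric] m1_def[symmetric]
    by (simp add: orth orth' field_simps)
  then show ?thesis using AEg q by (simp add: g_def)
qed

end

lemma (in two_level) SLD_c2:
  assumes "SLD L"
  shows "AE r in lborel. L c2 r = 2 * d2 r"
proof -
  interpret swap: two_level R c2 c1 d2 d1
    using in_L2 orth orth' real norm_nz by unfold_locales (auto simp: R_eq add.commute)
  have "swap.tangent = tangent"
    by (auto simp: swap.tangent_def tangent_def fun_eq_iff)
  then have "swap.SLD L" using assms by (simp add: swap.SLD_def SLD_def)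
  then show ?thesis by (rule swap.SLD_c1)
qed

text \<open>The trace is \<open>braket (L' \<pi>) (R (L \<pi>))\<close>. Expanding \<open>R\<close>
  and moving \<open>L\<close> and \<open>L'\<close> across by self-adjointness leaves only their
  values on \<open>c1\<close> and \<open>c2\<close>, so the choice of the two operators does not
  matter.\<close>

lemma oper_trace_SLD:
  assumes B: "orthonormal_basis B" and \<pi>: "\<pi> \<in> L2"
    and tl: "two_level R c1 c2 d1 d2" "two_level R c1 c2 d1' d2'"
    and L: "two_level.SLD R c1 c2 d1 d2 L" and L': "two_level.SLD R c1 c2 d1' d2' L'"
  shows "oper_trace (R \<circ> L \<circ> ketbra \<pi> \<pi> \<circ> L') =
    4 * (braket \<pi> d1' * braket d1 \<pi> + braket \<pi> d2' * braket d2 \<pi>)"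
proof -
  interpret A: two_level R c1 c2 d1 d2 by (rule tl)
  interpret A': two_level R c1 c2 d1' d2' by (rule tl)
  have b: "bounded_oper L" "bounded_oper L'" and s: "selfadjoint_oper L" "selfadjoint_oper L'"
    using L L' by (auto simp: A.SLD_def A'.SLD_def)
  have in2: "L \<pi> \<in> L2" "L' \<pi> \<in> L2" "L c1 \<in> L2" "L c2 \<in> L2" "L' c1 \<in> L2" "L' c2 \<in> L2"
    using \<pi> A.in_L2 by (intro b[THEN bounded_oper_L2]; simp)+
  have "oper_trace (R \<circ> L \<circ> ketbra \<pi> \<pi> \<circ> L') = braket (L' \<pi>) (R (L \<pi>))"
  proof (rule oper_trace_rank_one[OF B])
    fix e assume e: "e \<in> L2"
    \<comment> \<open>Scalars pass through \<open>L\<close> only almost everywhere; they are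
      therefore pulled out inside brackets, which ignore null sets.\<close>
    define \<kappa> where "\<kappa> = braket \<pi> (L' e)"
    have eq: "ketbra \<pi> \<pi> (L' e) = (\<lambda>r. \<kappa> * \<pi> r)" by (simp add: ketbra_def \<kappa>_def mult.commute)
    have LkL: "L (\<lambda>r. \<kappa> * \<pi> r) \<in> L2" using \<pi> by (intro b(1)[THEN bounded_oper_L2]) auto
    have "AE r in lborel. L (\<lambda>r. \<kappa> * \<pi> r) r = \<kappa> * L \<pi> r"
      using b \<pi> by (intro bounded_oper_cmult)
    then have br: "braket h (L (\<lambda>r. \<kappa> * \<pi> r)) = \<kappa> * braket h (L \<pi>)" if "h \<in> L2" for h
      using braket_cong_AE[OF that that LkL L2_cmult[OF in2(1)], of \<kappa>]
      by (simp add: braket_cmult_right)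
    have "braket e (R (L (\<lambda>r. \<kappa> * \<pi> r))) = \<kappa> * braket e (R (L \<pi>))"
      using e A.in_L2 in2 LkL by (simp add: A.braket_R br algebra_simps)
    moreover have "\<kappa> = braket (L' \<pi>) e"
      unfolding \<kappa>_def using s(2) \<pi> e by (simp add: selfadjoint_oper_def)
    ultimately show "braket e ((R \<circ> L \<circ> ketbra \<pi> \<pi> \<circ> L') e) = braket (L' \<pi>) e * braket e (R (L \<pi>))"
      by (simp add: eq)
  qed (use in2 A.L2_R in auto)
  also have "\<dots> = braket (L' \<pi>) c1 * braket c1 (L \<pi>) + braket (L' \<pi>) c2 * braket c2 (L \<pi>)"
    using in2 by (simp add: A.braket_R)
  also have "\<dots> = braket \<pi> (L' c1) * braket (L c1) \<pi> + braket \<pi> (L' c2) * braket (L c2) \<pi>"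
    using s \<pi> A.in_L2 by (simp add: selfadjoint_oper_def)
  also have "\<dots> = braket \<pi> (\<lambda>r. 2 * d1' r) * braket (\<lambda>r. 2 * d1 r) \<pi> +
      braket \<pi> (\<lambda>r. 2 * d2' r) * braket (\<lambda>r. 2 * d2 r) \<pi>"
    using in2 \<pi> A.in_L2 A'.in_L2 A.SLD_c1[OF L] A.SLD_c2[OF L] A'.SLD_c1[OF L'] A'.SLD_c2[OF L']
    by (intro arg_cong2[of _ _ _ _ "(+)"] arg_cong2[of _ _ _ _ "(*)"] braket_cong_AE L2_cmult) auto
  finally show ?thesis
    unfolding braket_cmult_left braket_cmult_right by (simp add: algebra_simps)
qed

section \<open>Differentiability in operator norm\<close>

text \<open>A first-order expansion of \<open>W\<close> with remainder dominated by
  \<open>\<eta>\<close> passes to the projection onto \<open>W\<close>. The vector \<open>f\<close>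
  enters the bound only through its norm, which is the uniformity that an operator-norm derivative
  demands.\<close>

lemma ketbra_derivative_bound:
  fixes W :: "real \<Rightarrow> wavefun"
  assumes \<eta>: "\<eta> \<in> L2" and W: "\<And>x. W x \<in> L2" and d: "d \<in> L2"
    and bW: "\<And>x r. cmod (W x r) \<le> cmod (\<eta> r)"
    and bd: "\<And>r. cmod (d r) \<le> M * cmod (\<eta> r)"
    and bq: "\<And>x r. cmod (W x r - W 0 r - complex_of_real x * d r) \<le> M * x\<^sup>2 * cmod (\<eta> r)"
    and x: "x \<noteq> 0" "\<bar>x\<bar> \<le> 1" and f: "f \<in> L2" and M: "M \<ge> 0"
  shows "cmod ((ketbra (W x) (W x) f r - ketbra (W 0) (W 0) f r) / complex_of_real x
      - (ketbra d (W 0) f r + ketbra (W 0) d f r))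
    \<le> \<bar>x\<bar> * (2 * M + 2 * M\<^sup>2) * (L2_norm \<eta> * L2_norm f) * cmod (\<eta> r)"
proof -
  let ?X = "L2_norm \<eta> * L2_norm f"
  have br: "cmod (braket u f) \<le> c * ?X" if u: "u \<in> L2" and le: "\<And>r. cmod (u r) \<le> c * cmod (\<eta> r)"
    and c: "c \<ge> 0" for u c
  proof -
    have "L2_norm u \<le> L2_norm (\<lambda>r. complex_of_real c * \<eta> r)"
      using u le c \<eta> by (intro L2_norm_mono L2_cmult L2_measurable) (auto simp: norm_mult)
    then have "L2_norm u \<le> c * L2_norm \<eta>" using c by (simp add: L2_norm_cmult)
    then have "L2_norm u * L2_norm f \<le> c * L2_norm \<eta> * L2_norm f"
      by (rule mult_right_mono) simp
    then show ?thesis using L2_Cauchy_Schwarz[OF u f] by (simp add: mult.assoc)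
  qed
  define q where "q = (\<lambda>r. W x r - W 0 r - complex_of_real x * d r)"
  have q: "q \<in> L2" unfolding q_def using W d by (intro L2_diff L2_cmult)
  define A Aq Ad A0 where "A = braket (W x) f" and "Aq = braket q f" and "Ad = braket d f"
    and "A0 = braket (W 0) f"
  have X0: "?X \<ge> 0" by simp
  have A: "cmod A \<le> ?X" unfolding A_def using br[OF W, of x 1] bW by simp
  have Aq: "cmod Aq \<le> M * x\<^sup>2 * ?X"
    unfolding Aq_def using br[OF q, of "M * x\<^sup>2"] bq M by (simp add: q_def)
  have Ad: "cmod Ad \<le> M * ?X" unfolding Ad_def using br[OF d bd M] .
  have Wx: "W x = (\<lambda>r. W 0 r + (complex_of_real x * d r + q r))" by (simp add: q_def)
  have "A = A0 + (complex_of_real x * Ad + Aq)"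
    unfolding A_def A0_def Ad_def Aq_def using W d q f
    by (subst Wx) (simp add: braket_add_left L2_add L2_cmult braket_cmult_left)
  then have A0: "A - A0 = complex_of_real x * Ad + Aq" by simp
  have x2: "x\<^sup>2 \<le> \<bar>x\<bar>" using x power_decreasing[of 1 2 "\<bar>x\<bar>"] by simp
  have xx: "x\<^sup>2 = \<bar>x\<bar> * \<bar>x\<bar>" by (simp add: power2_eq_square)
  have divx: "u / \<bar>x\<bar> \<le> \<bar>x\<bar> * c" if "u \<le> c * x\<^sup>2" for u c :: real
  proof -
    have "u \<le> (\<bar>x\<bar> * c) * \<bar>x\<bar>" using that unfolding xx by (simp only: mult_ac)
    then show ?thesis using x(1) by (metis pos_divide_le_eq zero_less_abs_iff)
  qed
  \<comment> \<open>Telescoping the product so that every summand contains a small factor: the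
    remainder \<open>q\<close> divided by \<open>x\<close>, the increment of the overlap, or the
    overlap of the remainder divided by \<open>x\<close>.\<close>
  have "(ketbra (W x) (W x) f r - ketbra (W 0) (W 0) f r) / complex_of_real x
      - (ketbra d (W 0) f r + ketbra (W 0) d f r) =
      q r / x * A + d r * (A - A0) + W 0 r * (Aq / x)"
  proof -
    have "ketbra (W x) (W x) f r - ketbra (W 0) (W 0) f r = W x r * A - W 0 r * A0"
      by (simp add: ketbra_def A_def A0_def)
    also have "\<dots> = (x * d r + q r) * A + W 0 r * (x * Ad + Aq)"
      unfolding A0[symmetric] by (simp add: q_def algebra_simps)
    finally have 1: "ketbra (W x) (W x) f r - ketbra (W 0) (W 0) f r =
        (x * d r + q r) * A + W 0 r * (x * Ad + Aq)" .
    have 2: "ketbra d (W 0) f r + ketbra (W 0) d f r = d r * A0 + W 0 r * Ad"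
      by (simp add: ketbra_def A0_def Ad_def)
    show ?thesis unfolding 1 2 using x(1) by (simp add: field_simps)
  qed
  also have "cmod \<dots> \<le> cmod (q r / x * A) + cmod (d r * (A - A0)) + cmod (W 0 r * (Aq / x))"
    by (meson norm_triangle_ineq norm_triangle_le add_right_mono order_trans)
  \<comment> \<open>The three summands contribute \<open>M\<close>, \<open>M * (M + M)\<close> and
    \<open>M\<close>, whence the constant \<open>2 * M + 2 * M\<^sup>2\<close>.\<close>
  also have "\<dots> \<le> (\<bar>x\<bar> * M * cmod (\<eta> r)) * ?X + (M * cmod (\<eta> r)) * (\<bar>x\<bar> * (M + M) * ?X)
      + cmod (\<eta> r) * (\<bar>x\<bar> * M * ?X)"
  proof (intro add_mono)
    have "cmod (q r / x) \<le> \<bar>x\<bar> * M * cmod (\<eta> r)"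
      using divx[of "cmod (q r)" "M * cmod (\<eta> r)"] bq[of x r] by (simp add: norm_divide q_def mult_ac)
    then show "cmod (q r / x * A) \<le> (\<bar>x\<bar> * M * cmod (\<eta> r)) * ?X"
      unfolding norm_mult using A M by (intro mult_mono) auto
    have "cmod (A - A0) \<le> cmod (complex_of_real x * Ad) + cmod Aq"
      unfolding A0 by (rule norm_triangle_ineq)
    also have "\<dots> \<le> \<bar>x\<bar> * (M * ?X) + M * \<bar>x\<bar> * ?X"
    proof (rule add_mono)
      show "cmod (complex_of_real x * Ad) \<le> \<bar>x\<bar> * (M * ?X)"
        unfolding norm_mult norm_of_real using Ad by (rule mult_left_mono) simp
      have "M * x\<^sup>2 * ?X \<le> M * \<bar>x\<bar> * ?X" using x2 M by (intro mult_right_mono mult_left_mono) auto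
      then show "cmod Aq \<le> M * \<bar>x\<bar> * ?X" using Aq by linarith
    qed
    finally have "cmod (A - A0) \<le> \<bar>x\<bar> * (M + M) * ?X" by (simp add: algebra_simps)
    then show "cmod (d r * (A - A0)) \<le> (M * cmod (\<eta> r)) * (\<bar>x\<bar> * (M + M) * ?X)"
      unfolding norm_mult using bd M by (intro mult_mono) auto
    have "cmod (Aq / x) \<le> \<bar>x\<bar> * M * ?X"
      using divx[of "cmod Aq" "M * ?X"] Aq by (simp add: norm_divide mult_ac)
    then show "cmod (W 0 r * (Aq / x)) \<le> cmod (\<eta> r) * (\<bar>x\<bar> * M * ?X)"
      unfolding norm_mult using bW by (intro mult_mono) auto
  qed
  also have "\<dots> = \<bar>x\<bar> * (2 * M + 2 * M\<^sup>2) * ?X * cmod (\<eta> r)"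
    by (simp add: algebra_simps power2_eq_square)
  finally show ?thesis .
qed

lemma has_oper_derivative_two_ketbras:
  fixes V W :: "real \<Rightarrow> wavefun"
  assumes \<eta>: "\<eta> \<in> L2" and M: "M \<ge> 0"
    and V: "\<And>x. V x \<in> L2" "c \<in> L2" "\<And>x r. cmod (V x r) \<le> cmod (\<eta> r)"
      "\<And>r. cmod (c r) \<le> M * cmod (\<eta> r)"
      "\<And>x r. cmod (V x r - V 0 r - complex_of_real x * c r) \<le> M * x\<^sup>2 * cmod (\<eta> r)"
    and W: "\<And>x. W x \<in> L2" "d \<in> L2" "\<And>x r. cmod (W x r) \<le> cmod (\<eta> r)"
      "\<And>r. cmod (d r) \<le> M * cmod (\<eta> r)"
      "\<And>x r. cmod (W x r - W 0 r - complex_of_real x * d r) \<le> M * x\<^sup>2 * cmod (\<eta> r)"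
    and T: "\<And>x f. f \<in> L2 \<Longrightarrow> T x f = (\<lambda>r. ketbra (V x) (V x) f r + ketbra (W x) (W x) f r)"
    and D: "\<And>f. f \<in> L2 \<Longrightarrow> D f =
      (\<lambda>r. (ketbra c (V 0) f r + ketbra (V 0) c f r) + (ketbra d (W 0) f r + ketbra (W 0) d f r))"
  shows "has_oper_derivative T D"
  unfolding has_oper_derivative_def
proof (intro allI impI)
  fix \<epsilon> :: real assume "\<epsilon> > 0"
  \<comment> \<open>The leading 2 counts the two projections. One factor
    \<open>L2_norm \<eta>\<close> comes from the pointwise bound, the other from integrating the
    dominating function.\<close>
  define K where "K = 2 * (2 * M + 2 * M\<^sup>2) * L2_norm \<eta> * L2_norm \<eta>"
  have K: "K \<ge> 0" unfolding K_def using M by simp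
  have "((\<lambda>x. \<bar>x\<bar> * K) \<longlongrightarrow> 0) (at 0)" by (auto intro!: tendsto_eq_intros)
  then have ev: "\<forall>\<^sub>F x in at 0. \<bar>x\<bar> * K < \<epsilon>" using \<open>\<epsilon> > 0\<close> by (rule order_tendstoD)
  have "((\<lambda>x. \<bar>x\<bar>) \<longlongrightarrow> (0::real)) (at 0)" by (auto intro!: tendsto_eq_intros)
  then have ev1: "\<forall>\<^sub>F x in at 0. \<bar>x\<bar> < (1::real)" by (rule order_tendstoD) simp
  show "\<forall>\<^sub>F x in at 0. \<forall>f\<in>L2. L2_norm (\<lambda>r. (T x f r - T 0 f r) / complex_of_real x - D f r) \<le> \<epsilon> * L2_norm f"
    using ev ev1 eventually_neq_at_within[of 0 0 UNIV]
  proof eventually_elim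
    fix x :: real assume x: "\<bar>x\<bar> * K < \<epsilon>" "\<bar>x\<bar> < 1" "x \<noteq> 0"
    show "\<forall>f\<in>L2. L2_norm (\<lambda>r. (T x f r - T 0 f r) / complex_of_real x - D f r) \<le> \<epsilon> * L2_norm f"
    proof
      fix f assume f: "f \<in> L2"
      define b where "b = \<bar>x\<bar> * (2 * M + 2 * M\<^sup>2) * (L2_norm \<eta> * L2_norm f)"
      have b: "b \<ge> 0" unfolding b_def using M by simp
      have le: "cmod ((T x f r - T 0 f r) / complex_of_real x - D f r) \<le> 2 * b * cmod (\<eta> r)" for r
      proof -
        let ?v = "(ketbra (V x) (V x) f r - ketbra (V 0) (V 0) f r) / complex_of_real x
            - (ketbra c (V 0) f r + ketbra (V 0) c f r)"
        let ?w = "(ketbra (W x) (W x) f r - ketbra (W 0) (W 0) f r) / complex_of_real x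
            - (ketbra d (W 0) f r + ketbra (W 0) d f r)"
        have eq: "(T x f r - T 0 f r) / complex_of_real x - D f r = ?v + ?w"
          unfolding T[OF f] D[OF f] by (simp add: diff_divide_distrib add_divide_distrib)
        have "cmod ?v \<le> b * cmod (\<eta> r)"
          unfolding b_def using x f by (intro ketbra_derivative_bound \<eta> V M) auto
        moreover have "cmod ?w \<le> b * cmod (\<eta> r)"
          unfolding b_def using x f by (intro ketbra_derivative_bound \<eta> W M) auto
        ultimately have "cmod ?v + cmod ?w \<le> 2 * b * cmod (\<eta> r)" by linarith
        then show ?thesis unfolding eq by (rule order_trans[OF norm_triangle_ineq])
      qed
      have T2: "T y f \<in> L2" for y
        unfolding T[OF f] using V W by (intro L2_add L2_ketbra)
      have "D f \<in> L2" unfolding D[OF f] using V W by (intro L2_add L2_ketbra)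
      then have "(\<lambda>r. (1 / complex_of_real x) * (T x f r - T 0 f r) - D f r) \<in> L2"
        using T2 by (intro L2_diff L2_cmult)
      then have meas: "(\<lambda>r. (T x f r - T 0 f r) / complex_of_real x - D f r) \<in> borel_measurable lborel"
        by (auto dest: L2_measurable)
      have "L2_norm (\<lambda>r. (T x f r - T 0 f r) / complex_of_real x - D f r) \<le>
          L2_norm (\<lambda>r. complex_of_real (2 * b) * \<eta> r)"
        using le b meas \<eta> by (intro L2_norm_mono L2_cmult) (auto simp: norm_mult)
      also have "\<dots> = 2 * b * L2_norm \<eta>" using b by (simp add: L2_norm_cmult norm_mult)
      also have "\<dots> = \<bar>x\<bar> * K * L2_norm f" by (simp add: b_def K_def)
      also have "\<dots> \<le> \<epsilon> * L2_norm f" using x by (intro mult_right_mono) auto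
      finally show "L2_norm (\<lambda>r. (T x f r - T 0 f r) / complex_of_real x - D f r) \<le> \<epsilon> * L2_norm f" .
    qed
  qed
qed

section \<open>Parity and oscillating integrals\<close>

lemma lborel_distr_uminus_euclidean: "distr lborel borel uminus = (lborel :: 'a::euclidean_space measure)"
proof -
  have "(lborel :: 'a measure) = density (distr lborel borel (\<lambda>x. 0 + (-1) *\<^sub>R x)) (\<lambda>_. ennreal (\<bar>-1\<bar> ^ DIM('a)))"
    by (rule lborel_affine) simp
  also have "\<dots> = distr lborel borel uminus"
    by (simp add: density_1)
  finally show ?thesis ..
qed

lemma integral_lborel_reflect:
  fixes f :: "'a::euclidean_space \<Rightarrow> 'b::{banach, second_countable_topology}"
  assumes "f \<in> borel_measurable lborel"
  shows "(LINT x|lborel. f (- x)) = (LINT x|lborel. f x)"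
proof -
  have "(LINT x|lborel. f x) = (LINT x|distr lborel borel uminus. f x)"
    by (simp add: lborel_distr_uminus_euclidean)
  also have "\<dots> = (LINT x|lborel. f (- x))"
    using assms by (intro integral_distr) auto
  finally show ?thesis ..
qed

text \<open>Reflection turns the integral into its own negative. The integral of a non-integrable
  function is 0, so measurability is enough.\<close>

lemma integral_lborel_odd:
  fixes f :: "'a::euclidean_space \<Rightarrow> real"
  assumes "f \<in> borel_measurable lborel" "AE x in lborel. f (- x) = - f x"
  shows "(LINT x|lborel. f x) = 0"
proof -
  have "(LINT x|lborel. f (- x)) = (LINT x|lborel. - f x)"
    using assms by (intro integral_cong_AE) (auto intro: measurable_compose[of uminus])
  then show ?thesis using integral_lborel_reflect[OF assms(1)] by simp
qed

section \<open>First-order expansion of the cosine and of cosine integrals\<close>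

text \<open>Mean value inequality for the remainder: since the sine is 1-Lipschitz, its derivative
  is at most \<open>\<bar>d\<bar>\<close> on the ball of radius \<open>\<bar>d\<bar>\<close>. The
  constant 1 in place of the sharp 1/2 suffices.\<close>

lemma abs_cos_add_first_order: "\<bar>cos (y + d) - cos y + d * sin y\<bar> \<le> d\<^sup>2" for y d :: real
proof -
  have sin_lip: "\<bar>sin u - sin v\<bar> \<le> \<bar>u - v\<bar>" for u v :: real
  proof -
    have "\<bar>sin u - sin v\<bar> = \<bar>2 * (sin ((u - v) / 2) * cos ((u + v) / 2))\<bar>"
      by (simp add: sin_diff_sin)
    also have "\<dots> = 2 * (\<bar>sin ((u - v) / 2)\<bar> * \<bar>cos ((u + v) / 2)\<bar>)"
      by (simp add: abs_mult)
    also have "\<dots> \<le> 2 * (\<bar>(u - v) / 2\<bar> * 1)"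
      by (intro mult_left_mono mult_mono abs_sin_x_le_abs_x) auto
    finally show ?thesis by simp
  qed
  define f where "f = (\<lambda>x. cos (y + x) + x * sin y)"
  have "norm (f d - f 0) \<le> \<bar>d\<bar> * norm (d - 0)"
  proof (rule field_differentiable_bound[where f' = "\<lambda>x. - sin (y + x) + sin y" and S = "cball 0 \<bar>d\<bar>"])
    fix z :: real assume z: "z \<in> cball 0 \<bar>d\<bar>"
    show "(f has_field_derivative - sin (y + z) + sin y) (at z within cball 0 \<bar>d\<bar>)"
      unfolding f_def by (auto intro!: derivative_eq_intros)
    show "norm (- sin (y + z) + sin y) \<le> \<bar>d\<bar>"
      using sin_lip[of y "y + z"] z by simp
  qed auto
  then show ?thesis by (simp add: f_def power2_eq_square algebra_simps)
qed

text \<open>Bounded support makes the second-order remainder at most \<open>x\<^sup>2\<close> times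
  a multiple of \<open>\<bar>w r\<bar>\<close>, uniformly in \<open>r\<close>. The weight is kept
  general so that the result also applies to the weights produced by differentiation.\<close>

lemma cos_integral_has_derivative:
  fixes w :: "'a::euclidean_space \<Rightarrow> real"
  assumes w: "integrable lborel w" and supp: "\<And>r. norm r > R \<Longrightarrow> w r = 0"
  shows "((\<lambda>x. LINT r|lborel. w r * cos (k * ((\<sigma> + x *\<^sub>R v) \<bullet> r) - \<phi>)) has_real_derivative
      (LINT r|lborel. w r * (k * (v \<bullet> r)) * - sin (k * (\<sigma> \<bullet> r) - \<phi>))) (at 0)"
proof -
  have [measurable]: "w \<in> borel_measurable lborel" using w by auto
  \<comment> \<open>\<open>\<bar>R\<bar>\<close> is used because no sign of \<open>R\<close> is
    assumed.\<close>
  define C where "C = (k * norm v * \<bar>R\<bar>)\<^sup>2"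
  have kv: "(k * (v \<bullet> r))\<^sup>2 \<le> C" if "norm r \<le> R" for r
  proof -
    have "norm r \<le> \<bar>R\<bar>" using that by simp
    then have "\<bar>v \<bullet> r\<bar> \<le> norm v * \<bar>R\<bar>"
      using Cauchy_Schwarz_ineq2[of v r] mult_left_mono[OF _ norm_ge_zero[of v]] order_trans by blast
    then have "\<bar>k * (v \<bullet> r)\<bar> \<le> \<bar>k * norm v * \<bar>R\<bar>\<bar>"
      by (simp add: abs_mult mult.assoc mult_left_mono)
    then show ?thesis unfolding C_def by (simp add: abs_le_square_iff)
  qed
  have wint: "integrable lborel (\<lambda>r. w r * cos (g r))" if [measurable]: "g \<in> borel_measurable lborel" for g
  proof (rule Bochner_Integration.integrable_bound[OF w])
    show "AE r in lborel. norm (w r * cos (g r)) \<le> norm (w r)"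
      by (simp add: abs_mult mult_left_le)
  qed measurable
  have dint: "integrable lborel (\<lambda>r. w r * (k * (v \<bullet> r)) * - sin (k * (\<sigma> \<bullet> r) - \<phi>))"
  proof (rule Bochner_Integration.integrable_bound)
    show "integrable lborel (\<lambda>r. (1 + C) * w r)" using w by simp
    have "norm (w r * (k * (v \<bullet> r)) * - sin (k * (\<sigma> \<bullet> r) - \<phi>)) \<le> norm ((1 + C) * w r)" for r
    proof (cases "norm r \<le> R")
      case True
      \<comment> \<open>Bounding the modulus by 1 plus the square lets the constant \<open>C\<close>
        for the remainder dominate the first derivative too.\<close>
      have "\<bar>k * (v \<bullet> r)\<bar> \<le> 1 + (k * (v \<bullet> r))\<^sup>2"
        using zero_le_power2[of "\<bar>k * (v \<bullet> r)\<bar> - 1"] zero_le_power2[of "k * (v \<bullet> r)"]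
        unfolding power2_diff power2_abs power_one mult_1_right by linarith
      then have b: "\<bar>k * (v \<bullet> r)\<bar> * \<bar>sin (k * (\<sigma> \<bullet> r) - \<phi>)\<bar> \<le> (1 + C) * 1"
        using kv[OF True] zero_le_power2[of "k * (v \<bullet> r)"] by (intro mult_mono) auto
      have "norm (w r * (k * (v \<bullet> r)) * - sin (k * (\<sigma> \<bullet> r) - \<phi>)) =
          \<bar>w r\<bar> * (\<bar>k * (v \<bullet> r)\<bar> * \<bar>sin (k * (\<sigma> \<bullet> r) - \<phi>)\<bar>)"
        by (simp add: abs_mult mult_ac)
      also have "\<dots> \<le> \<bar>w r\<bar> * ((1 + C) * 1)" by (rule mult_left_mono[OF b]) simp
      also have "\<dots> \<le> norm ((1 + C) * w r)"
        using mult_left_mono[OF abs_ge_self[of "1 + C"] abs_ge_zero[of "w r"]] by (simp add: abs_mult mult_ac)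
      finally show ?thesis .
    qed (simp add: supp)
    then show "AE r in lborel. norm (w r * (k * (v \<bullet> r)) * - sin (k * (\<sigma> \<bullet> r) - \<phi>)) \<le> norm ((1 + C) * w r)"
      by simp
  qed measurable
  define G where "G = (\<lambda>x. LINT r|lborel. w r * cos (k * ((\<sigma> + x *\<^sub>R v) \<bullet> r) - \<phi>))"
  define D where "D = (LINT r|lborel. w r * (k * (v \<bullet> r)) * - sin (k * (\<sigma> \<bullet> r) - \<phi>))"
  define N where "N = (LINT r|lborel. C * \<bar>w r\<bar>)"
  have bound: "\<bar>G x - G 0 - x * D\<bar> \<le> x\<^sup>2 * N" for x
  proof -
    let ?h = "\<lambda>r. w r * cos (k * ((\<sigma> + x *\<^sub>R v) \<bullet> r) - \<phi>) - w r * cos (k * (\<sigma> \<bullet> r) - \<phi>) -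
        x * (w r * (k * (v \<bullet> r)) * - sin (k * (\<sigma> \<bullet> r) - \<phi>))"
    have int1: "integrable lborel (\<lambda>r. w r * cos (k * ((\<sigma> + x *\<^sub>R v) \<bullet> r) - \<phi>))"
      and int2: "integrable lborel (\<lambda>r. w r * cos (k * (\<sigma> \<bullet> r) - \<phi>))"
      by (intro wint; measurable)+
    have eq: "G x - G 0 - x * D = (LINT r|lborel. ?h r)"
      unfolding G_def D_def using int1 int2 dint by simp
    have le: "\<bar>?h r\<bar> \<le> x\<^sup>2 * (C * \<bar>w r\<bar>)" for r
    proof (cases "norm r \<le> R")
      case True
      define y where "y = k * (\<sigma> \<bullet> r) - \<phi>"
      define d where "d = x * (k * (v \<bullet> r))"
      have "?h r = w r * (cos (y + d) - cos y + d * sin y)"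
        by (simp add: y_def d_def algebra_simps inner_simps)
      then have "\<bar>?h r\<bar> \<le> \<bar>w r\<bar> * d\<^sup>2"
        using abs_cos_add_first_order[of y d] by (simp add: abs_mult mult_left_mono)
      also have "\<dots> \<le> \<bar>w r\<bar> * (x\<^sup>2 * C)"
        unfolding d_def power_mult_distrib[of x] using kv[OF True] by (intro mult_left_mono) auto
      finally show ?thesis by (simp add: mult_ac)
    qed (simp add: supp)
    have "\<bar>LINT r|lborel. ?h r\<bar> \<le> (LINT r|lborel. x\<^sup>2 * (C * \<bar>w r\<bar>))"
      using Bochner_Integration.integral_norm_bound_integral[of lborel ?h "\<lambda>r. x\<^sup>2 * (C * \<bar>w r\<bar>)"] le int1 int2 dint w
      by simp
    then show ?thesis unfolding eq N_def by simp
  qed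
  have "((\<lambda>x. (G x - G 0) / x - D) \<longlongrightarrow> 0) (at 0)"
  proof (rule Lim_null_comparison)
    show "((\<lambda>x. \<bar>x\<bar> * N) \<longlongrightarrow> 0) (at 0)"
      by (auto intro!: tendsto_eq_intros)
    show "\<forall>\<^sub>F x in at 0. norm ((G x - G 0) / x - D) \<le> \<bar>x\<bar> * N"
    proof (rule eventually_mono[OF eventually_neq_at_within[of 0]])
      fix x :: real assume "x \<noteq> 0"
      then have "norm ((G x - G 0) / x - D) = \<bar>G x - G 0 - x * D\<bar> / \<bar>x\<bar>"
        by (simp add: abs_divide[symmetric] diff_divide_distrib)
      also have "\<dots> \<le> \<bar>x\<bar> * N"
      proof -
        have "x\<^sup>2 = \<bar>x\<bar> * \<bar>x\<bar>" by (simp add: power2_eq_square)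
        then have "\<bar>G x - G 0 - x * D\<bar> \<le> (\<bar>x\<bar> * N) * \<bar>x\<bar>"
          using bound[of x] by (simp only: mult_ac)
        then show ?thesis using \<open>x \<noteq> 0\<close> by (subst pos_divide_le_eq) auto
      qed
      finally show "norm ((G x - G 0) / x - D) \<le> \<bar>x\<bar> * N" .
    qed
  qed
  then show ?thesis
    unfolding G_def[symmetric] D_def[symmetric] DERIV_def by (simp add: LIM_zero_iff)
qed

section \<open>The two-source state on the plane \<open>s$3 = 0\<close>\<close>

text \<open>For \<open>a > 0\<close> this is the common modulus of all functions
  \<open>Phi a k s\<close>, and it dominates every estimate on them.\<close>

definition aperture :: "real \<Rightarrow> real^2 \<Rightarrow> real" where
  "aperture a r = 1 / (sqrt pi * a) * circ (norm r / a)"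

text \<open>The real and imaginary parts of \<open>Phi\<close> on the plane \<open>s$3 = 0\<close> are the values at the
  phases \<open>0\<close> and \<open>pi/2\<close>.\<close>

definition wave :: "real \<Rightarrow> real \<Rightarrow> real \<Rightarrow> real^2 \<Rightarrow> real^2 \<Rightarrow> real" where
  "wave a k \<phi> \<sigma> r = aperture a r * cos (k * (\<sigma> \<bullet> r) - \<phi>)"

definition dwave :: "real \<Rightarrow> real \<Rightarrow> real \<Rightarrow> real^2 \<Rightarrow> real^2 \<Rightarrow> real^2 \<Rightarrow> real" where
  "dwave a k \<phi> v \<sigma> r = aperture a r * (k * (v \<bullet> r)) * - sin (k * (\<sigma> \<bullet> r) - \<phi>)"

abbreviation cplx :: "(real^2 \<Rightarrow> real) \<Rightarrow> wavefun" where
  "cplx g \<equiv> (\<lambda>r. complex_of_real (g r))"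

lemma circ_measurable [measurable]: "circ \<in> borel_measurable borel"
  unfolding circ_def by measurable

lemma aperture_measurable [measurable]: "aperture a \<in> borel_measurable borel"
  unfolding aperture_def[abs_def] by measurable

lemma wave_measurable [measurable]: "wave a k \<phi> \<sigma> \<in> borel_measurable borel"
  unfolding wave_def[abs_def] by measurable

lemma dwave_measurable [measurable]: "dwave a k \<phi> v \<sigma> \<in> borel_measurable borel"
  unfolding dwave_def[abs_def] by measurable

lemma aperture_eq_0: "a > 0 \<Longrightarrow> norm r > a \<Longrightarrow> aperture a r = 0"
  by (simp add: aperture_def circ_def)

lemma aperture_pos: "a > 0 \<Longrightarrow> norm r \<le> a \<Longrightarrow> aperture a r > 0"
  by (simp add: aperture_def circ_def)

lemma aperture_nonneg: "a > 0 \<Longrightarrow> aperture a r \<ge> 0"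
  by (simp add: aperture_def circ_def)

lemma aperture_uminus: "aperture a (- r) = aperture a r"
  by (simp add: aperture_def)

lemma L2_aperture:
  assumes "a > 0" shows "cplx (aperture a) \<in> L2"
proof -
  have "integrable lborel (\<lambda>r::real^2. (1 / (sqrt pi * a))\<^sup>2 * indicator (cball 0 a) r)"
    using emeasure_lborel_cball_finite[of "0::real^2" a]
    by (intro integrable_mult_right integrable_real_indicator) auto
  moreover have "(1 / (sqrt pi * a))\<^sup>2 * indicator (cball 0 a) r = (cmod (complex_of_real (aperture a r)))\<^sup>2"
    for r :: "real^2"
    unfolding norm_of_real using assms by (auto simp: aperture_def circ_def indicator_def)
  ultimately have "integrable lborel (\<lambda>r. (cmod (complex_of_real (aperture a r)))\<^sup>2)" by simp
  then show ?thesis by (simp add: L2_def)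
qed

lemma L2_cplx_if_bounded:
  assumes "a > 0" "g \<in> borel_measurable borel" "\<And>r. \<bar>g r\<bar> \<le> M * aperture a r"
  shows "cplx g \<in> L2"
proof -
  have [measurable]: "g \<in> borel_measurable lborel" using assms by simp
  have "integrable lborel (\<lambda>r. (cmod (complex_of_real (g r)))\<^sup>2)"
  proof (rule Bochner_Integration.integrable_bound)
    show "integrable lborel (\<lambda>r. M\<^sup>2 * (cmod (complex_of_real (aperture a r)))\<^sup>2)"
      using L2_integrable_square[OF L2_aperture[OF assms(1)]] by simp
    have "(g r)\<^sup>2 \<le> M\<^sup>2 * (aperture a r)\<^sup>2" for r
      using power_mono[OF assms(3)[of r] abs_ge_zero, of 2] by (simp add: power_mult_distrib)
    then show "AE r in lborel. norm ((cmod (complex_of_real (g r)))\<^sup>2) \<le>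
        norm (M\<^sup>2 * (cmod (complex_of_real (aperture a r)))\<^sup>2)"
      by simp
  qed measurable
  then show ?thesis by (simp add: L2_def)
qed

text \<open>Largest rate of phase change inside the aperture when the separation moves along
  \<open>v\<close>. It bounds the first derivative of the amplitude, and its square bounds the
  second-order remainder.\<close>

definition tilt_bound :: "real \<Rightarrow> real \<Rightarrow> real^2 \<Rightarrow> real" where
  "tilt_bound a k v = \<bar>k\<bar> * norm v * a"

lemma tilt_le:
  assumes "norm r \<le> a"
  shows "\<bar>k * (v \<bullet> r)\<bar> \<le> tilt_bound a k v"
proof -
  have "\<bar>v \<bullet> r\<bar> \<le> norm v * a"
    using Cauchy_Schwarz_ineq2[of v r] mult_left_mono[OF assms norm_ge_zero[of v]] by linarith
  then show ?thesis by (simp add: tilt_bound_def abs_mult mult.assoc mult_left_mono)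
qed

lemma abs_wave_le: "a > 0 \<Longrightarrow> \<bar>wave a k \<phi> \<sigma> r\<bar> \<le> aperture a r"
  using aperture_nonneg[of a r] by (simp add: wave_def abs_mult mult_left_le)

lemma abs_dwave_le:
  assumes "a > 0"
  shows "\<bar>dwave a k \<phi> v \<sigma> r\<bar> \<le> tilt_bound a k v * aperture a r"
proof (cases "norm r \<le> a")
  case True
  have "\<bar>dwave a k \<phi> v \<sigma> r\<bar> = (\<bar>k * (v \<bullet> r)\<bar> * aperture a r) * \<bar>sin (k * (\<sigma> \<bullet> r) - \<phi>)\<bar>"
    using aperture_nonneg[OF assms, of r] by (simp add: dwave_def abs_mult)
  also have "\<dots> \<le> \<bar>k * (v \<bullet> r)\<bar> * aperture a r"
    using aperture_nonneg[OF assms, of r] by (intro mult_left_le) auto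
  also have "\<dots> \<le> tilt_bound a k v * aperture a r"
    using tilt_le[OF True] aperture_nonneg[OF assms] by (rule mult_right_mono)
  finally show ?thesis .
qed (use assms aperture_eq_0 in \<open>simp add: dwave_def\<close>)

lemma wave_first_order:
  assumes "a > 0"
  shows "\<bar>wave a k \<phi> (\<sigma> + x *\<^sub>R v) r - wave a k \<phi> \<sigma> r - x * dwave a k \<phi> v \<sigma> r\<bar>
    \<le> (tilt_bound a k v)\<^sup>2 * x\<^sup>2 * aperture a r"
proof (cases "norm r \<le> a")
  case True
  define y where "y = k * (\<sigma> \<bullet> r) - \<phi>"
  define d where "d = x * (k * (v \<bullet> r))"
  have "wave a k \<phi> (\<sigma> + x *\<^sub>R v) r - wave a k \<phi> \<sigma> r - x * dwave a k \<phi> v \<sigma> r =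
      aperture a r * (cos (y + d) - cos y + d * sin y)"
    by (simp add: wave_def dwave_def y_def d_def algebra_simps inner_simps)
  then have "\<bar>wave a k \<phi> (\<sigma> + x *\<^sub>R v) r - wave a k \<phi> \<sigma> r - x * dwave a k \<phi> v \<sigma> r\<bar> \<le> aperture a r * d\<^sup>2"
    using abs_cos_add_first_order[of y d] aperture_nonneg[OF assms, of r]
    by (simp add: abs_mult mult_left_mono)
  also have "\<dots> \<le> aperture a r * ((tilt_bound a k v)\<^sup>2 * x\<^sup>2)"
  proof (rule mult_left_mono[OF _ aperture_nonneg[OF assms]])
    have "(k * (v \<bullet> r))\<^sup>2 \<le> (tilt_bound a k v)\<^sup>2"
      using power_mono[OF tilt_le[OF True] abs_ge_zero, of k v 2] by simp
    then show "d\<^sup>2 \<le> (tilt_bound a k v)\<^sup>2 * x\<^sup>2"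
      unfolding d_def power_mult_distrib[of x] by (subst mult.commute) (rule mult_right_mono, simp_all)
  qed
  finally show ?thesis by (simp add: mult_ac)
qed (use assms aperture_eq_0 in \<open>simp add: dwave_def wave_def\<close>)

lemma L2_wave: "a > 0 \<Longrightarrow> cplx (wave a k \<phi> \<sigma>) \<in> L2"
  using abs_wave_le by (intro L2_cplx_if_bounded[of a _ 1]) auto

lemma L2_dwave: "a > 0 \<Longrightarrow> cplx (dwave a k \<phi> v \<sigma>) \<in> L2"
  using abs_dwave_le by (intro L2_cplx_if_bounded[of a _ "tilt_bound a k v"]) auto

lemma braket_cplx: "braket (cplx f) (cplx g) = complex_of_real (LINT r|lborel. f r * g r)"
  by (simp add: braket_def flip: of_real_mult integral_complex_of_real)

text \<open>Differentiation brings down the odd factor \<open>v \<bullet> r\<close> and exchanges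
  cosine and sine, two changes of parity that cancel.\<close>

lemma wave_uminus:
  "wave a k 0 \<sigma> (- r) = wave a k 0 \<sigma> r"
  "wave a k (pi/2) \<sigma> (- r) = - wave a k (pi/2) \<sigma> r"
  "dwave a k 0 v \<sigma> (- r) = dwave a k 0 v \<sigma> r"
  "dwave a k (pi/2) v \<sigma> (- r) = - dwave a k (pi/2) v \<sigma> r"
  by (simp_all add: wave_def dwave_def aperture_uminus cos_diff sin_diff)

lemma braket_cplx_odd:
  assumes "f \<in> borel_measurable lborel" "g \<in> borel_measurable lborel"
    and "AE r in lborel. f (- r) * g (- r) = - (f r * g r)"
  shows "braket (cplx f) (cplx g) = 0"
  using integral_lborel_odd[of "\<lambda>r. f r * g r"] assms by (simp add: braket_cplx)

text \<open>An amplitude that is zero almost everywhere would make the cosine vanish almost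
  everywhere on the open disc. The zero set of the cosine is closed, so it would contain the whole
  disc and with it \<open>r0\<close>.\<close>

lemma wave_L2_norm_nz:
  assumes "a > 0" and r0: "norm r0 < a" "cos (k * (\<sigma> \<bullet> r0) - \<phi>) \<noteq> 0"
  shows "L2_norm (cplx (wave a k \<phi> \<sigma>)) \<noteq> 0"
proof
  assume "L2_norm (cplx (wave a k \<phi> \<sigma>)) = 0"
  then have "AE r in lborel. wave a k \<phi> \<sigma> r = 0"
    using AE_zero_if_L2_norm_zero[OF L2_wave[OF assms(1)]] by simp
  then have "AE r in lebesgue. wave a k \<phi> \<sigma> r = 0" by (rule AE_completion)
  then have "AE r \<in> ball 0 a in lebesgue. r \<in> {r. cos (k * (\<sigma> \<bullet> r) - \<phi>) = 0}"
  proof eventually_elim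
    fix r assume "wave a k \<phi> \<sigma> r = 0"
    then show "r \<in> ball 0 a \<longrightarrow> r \<in> {r. cos (k * (\<sigma> \<bullet> r) - \<phi>) = 0}"
      using aperture_pos[OF assms(1), of r] by (auto simp: wave_def)
  qed
  then have "r0 \<in> {r. cos (k * (\<sigma> \<bullet> r) - \<phi>) = 0}"
  proof (rule mem_closed_if_AE_lebesgue_open[rotated 2])
    show "closed {r. cos (k * (\<sigma> \<bullet> r) - \<phi>) = 0}"
      by (intro closed_Collect_eq continuous_intros)
  qed (use r0 in auto)
  then show False using r0 by simp
qed

lemma wave_0_norm_nz: "a > 0 \<Longrightarrow> L2_norm (cplx (wave a k 0 \<sigma>)) \<noteq> 0"
  by (rule wave_L2_norm_nz[of a 0]) auto

lemma wave_pi2_norm_nz: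
  assumes "a > 0" "k > 0" "\<sigma> \<noteq> 0"
  shows "L2_norm (cplx (wave a k (pi/2) \<sigma>)) \<noteq> 0"
proof -
  \<comment> \<open>The first entry of the minimum puts \<open>t *\<^sub>R \<sigma>\<close> within
    half the radius of the disc; the second keeps the phase in the interval from 0 to 1, where the
    sine is positive.\<close>
  define t where "t = min (a / (2 * norm \<sigma>)) (1 / (k * (norm \<sigma>)\<^sup>2))"
  have n: "norm \<sigma> > 0" using assms by simp
  have t: "t > 0" using assms n by (simp add: t_def)
  have "t * norm \<sigma> \<le> a / (2 * norm \<sigma>) * norm \<sigma>" using n by (intro mult_right_mono) (auto simp: t_def)
  then have 1: "norm (t *\<^sub>R \<sigma>) < a" using n t assms by simp
  have "t * (k * (norm \<sigma>)\<^sup>2) \<le> 1 / (k * (norm \<sigma>)\<^sup>2) * (k * (norm \<sigma>)\<^sup>2)"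
    using n assms by (intro mult_right_mono) (auto simp: t_def)
  then have "k * (\<sigma> \<bullet> (t *\<^sub>R \<sigma>)) \<le> 1"
    using n assms by (simp add: power2_norm_eq_inner mult_ac)
  moreover have "k * (\<sigma> \<bullet> (t *\<^sub>R \<sigma>)) > 0" using t assms by simp
  ultimately have "sin (k * (\<sigma> \<bullet> (t *\<^sub>R \<sigma>))) > 0"
    using pi_gt3 by (intro sin_gt_zero) auto
  then have 2: "cos (k * (\<sigma> \<bullet> (t *\<^sub>R \<sigma>)) - pi/2) \<noteq> 0" by (simp add: cos_diff)
  show ?thesis by (rule wave_L2_norm_nz[OF assms(1) 1 2])
qed

section \<open>The state as a two-level operator and its derivative\<close>

lemma transverse_simps [simp]:
  "transverse v $ 1 = v $ 1" "transverse v $ 2 = v $ 2" "transverse v $ 3 = 0"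
  by (simp_all add: transverse_def)

lemma transverse_add_scaleR: "transverse \<sigma> + x *\<^sub>R transverse v = transverse (\<sigma> + x *\<^sub>R v)"
  by (simp add: vec_eq_iff forall_3)

lemma Phi_transverse:
  "Phi a k (transverse \<sigma>) = (\<lambda>r. cplx (wave a k 0 \<sigma>) r + \<i> * cplx (wave a k (pi/2) \<sigma>) r)"
  "Phi a k (- transverse \<sigma>) = (\<lambda>r. cplx (wave a k 0 \<sigma>) r + (- \<i>) * cplx (wave a k (pi/2) \<sigma>) r)"
proof -
  have inner: "\<sigma> \<bullet> r = \<sigma>$1 * r$1 + \<sigma>$2 * r$2" for r by (simp add: inner_vec_def sum_2)
  have *: "exp (\<i> * complex_of_real y) = complex_of_real (cos y) + \<i> * complex_of_real (cos (y - pi/2))" for y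
    by (simp add: cis_conv_exp[symmetric] complex_eq_iff cos_diff)
  show "Phi a k (transverse \<sigma>) = (\<lambda>r. cplx (wave a k 0 \<sigma>) r + \<i> * cplx (wave a k (pi/2) \<sigma>) r)"
    unfolding Phi_def * by (simp add: fun_eq_iff wave_def aperture_def inner algebra_simps)
  have **: "k * ((- transverse \<sigma>)$1 * r$1 + (- transverse \<sigma>)$2 * r$2 - (- transverse \<sigma>)$3 * (norm r)\<^sup>2 / 2) =
      - (k * (\<sigma> \<bullet> r))" for r
    by (simp add: inner algebra_simps)
  have "cos (- y - pi/2) = - cos (y - pi/2)" for y :: real by (simp add: cos_diff)
  then show "Phi a k (- transverse \<sigma>) = (\<lambda>r. cplx (wave a k 0 \<sigma>) r + (- \<i>) * cplx (wave a k (pi/2) \<sigma>) r)"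
    unfolding Phi_def ** * by (simp add: fun_eq_iff wave_def aperture_def algebra_simps)
qed

text \<open>The cross terms between the two levels carry opposite signs in the two sources and
  cancel; the remaining terms occur twice and absorb the factor 1/2.\<close>

lemma rho_transverse:
  assumes "a > 0" "f \<in> L2"
  shows "rho a k (transverse \<sigma>) f =
    (\<lambda>r. ketbra (cplx (wave a k 0 \<sigma>)) (cplx (wave a k 0 \<sigma>)) f r +
         ketbra (cplx (wave a k (pi/2) \<sigma>)) (cplx (wave a k (pi/2) \<sigma>)) f r)"
proof -
  define C S where "C = cplx (wave a k 0 \<sigma>)" and "S = cplx (wave a k (pi/2) \<sigma>)"
  have CS: "C \<in> L2" "S \<in> L2" unfolding C_def S_def using assms L2_wave by auto
  have P: "Phi a k (transverse \<sigma>) = (\<lambda>r. C r + \<i> * S r)" "Phi a k (- transverse \<sigma>) = (\<lambda>r. C r + (- \<i>) * S r)"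
    unfolding C_def S_def by (simp_all only: Phi_transverse)
  have br: "braket (\<lambda>r. C r + z * S r) f = braket C f + cnj z * braket S f" for z
    using CS assms by (simp add: braket_add_left L2_cmult braket_cmult_left)
  have "rho a k (transverse \<sigma>) f = (\<lambda>r. ketbra C C f r + ketbra S S f r)"
    unfolding rho_def P ketbra_def br by (simp add: fun_eq_iff algebra_simps)
  then show ?thesis by (simp only: C_def S_def)
qed

text \<open>Orthogonality comes from opposite parity and reality of the overlaps from real
  amplitudes. The condition \<open>\<sigma> \<noteq> 0\<close> enters through the norm of the odd
  level, which is identically zero at the origin.\<close>

lemma two_level_rho:
  assumes "a > 0" "k > 0" "\<sigma> \<noteq> 0"
  shows "two_level (rho a k (transverse \<sigma>)) (cplx (wave a k 0 \<sigma>)) (cplx (wave a k (pi/2) \<sigma>))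
    (cplx (dwave a k 0 v \<sigma>)) (cplx (dwave a k (pi/2) v \<sigma>))"
proof
  show "braket (cplx (wave a k 0 \<sigma>)) (cplx (wave a k (pi/2) \<sigma>)) = 0"
    "braket (cplx (wave a k 0 \<sigma>)) (cplx (dwave a k (pi/2) v \<sigma>)) = 0"
    "braket (cplx (wave a k (pi/2) \<sigma>)) (cplx (dwave a k 0 v \<sigma>)) = 0"
    by (rule braket_cplx_odd; simp add: wave_uminus)+
qed (use assms in \<open>auto simp: L2_wave L2_dwave rho_transverse braket_cplx wave_0_norm_nz wave_pi2_norm_nz\<close>)

lemma rho_has_oper_derivative:
  assumes "a > 0"
    and D: "\<And>f. f \<in> L2 \<Longrightarrow> D f = (\<lambda>r.
      (ketbra (cplx (dwave a k 0 v \<sigma>)) (cplx (wave a k 0 \<sigma>)) f r +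
       ketbra (cplx (wave a k 0 \<sigma>)) (cplx (dwave a k 0 v \<sigma>)) f r) +
      (ketbra (cplx (dwave a k (pi/2) v \<sigma>)) (cplx (wave a k (pi/2) \<sigma>)) f r +
       ketbra (cplx (wave a k (pi/2) \<sigma>)) (cplx (dwave a k (pi/2) v \<sigma>)) f r))"
  shows "has_oper_derivative (\<lambda>x. rho a k (transverse \<sigma> + x *\<^sub>R transverse v)) D"
proof -
  \<comment> \<open>One constant that majorises both the first-derivative bound and the remainder
    constant.\<close>
  define M where "M = tilt_bound a k v + (tilt_bound a k v)\<^sup>2"
  have tb: "tilt_bound a k v \<ge> 0" using assms by (simp add: tilt_bound_def)
  then have M: "M \<ge> 0" "tilt_bound a k v \<le> M" "(tilt_bound a k v)\<^sup>2 \<le> M" by (auto simp: M_def)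
  note ap = aperture_nonneg[OF assms(1)]
  have 1: "cmod (cplx (wave a k \<phi> (\<sigma> + x *\<^sub>R v)) r) \<le> cmod (cplx (aperture a) r)" for \<phi> x r
    using abs_wave_le[OF assms(1)] ap by simp
  have 2: "cmod (cplx (dwave a k \<phi> v \<sigma>) r) \<le> M * cmod (cplx (aperture a) r)" for \<phi> r
    using abs_dwave_le[OF assms(1), of k \<phi> v \<sigma> r] mult_right_mono[OF M(2) ap[of r]] ap[of r] by simp
  have 3: "cmod (cplx (wave a k \<phi> (\<sigma> + x *\<^sub>R v)) r - cplx (wave a k \<phi> (\<sigma> + 0 *\<^sub>R v)) r
      - complex_of_real x * cplx (dwave a k \<phi> v \<sigma>) r) \<le> M * x\<^sup>2 * cmod (cplx (aperture a) r)" for \<phi> x r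
  proof -
    have "\<bar>wave a k \<phi> (\<sigma> + x *\<^sub>R v) r - wave a k \<phi> \<sigma> r - x * dwave a k \<phi> v \<sigma> r\<bar> \<le> M * x\<^sup>2 * aperture a r"
      using wave_first_order[OF assms(1), of k \<phi> \<sigma> x v r]
        mult_right_mono[OF mult_right_mono[OF M(3) zero_le_power2[of x]] ap[of r]] by linarith
    then show ?thesis using ap[of r] by (simp flip: of_real_mult of_real_diff)
  qed
  show ?thesis
    unfolding transverse_add_scaleR
    by (rule has_oper_derivative_two_ketbras[where \<eta> = "cplx (aperture a)" and M = M
          and V = "\<lambda>x. cplx (wave a k 0 (\<sigma> + x *\<^sub>R v))" and W = "\<lambda>x. cplx (wave a k (pi/2) (\<sigma> + x *\<^sub>R v))"
          and c = "cplx (dwave a k 0 v \<sigma>)" and d = "cplx (dwave a k (pi/2) v \<sigma>)"])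
      (use assms M(1) 1 2 3 in \<open>auto simp: L2_aperture L2_wave L2_dwave rho_transverse\<close>)
qed

section \<open>Evaluation of the bound and of the probability\<close>

text \<open>Bridges analysis and algebra: the operator derivative of the state is
  \<open>tangent\<close>, so an algebraic solution is a symmetric logarithmic derivative, and
  uniqueness of derivatives gives the converse almost everywhere.\<close>

lemma is_SLD_transverse:
  assumes "a > 0" "k > 0" "\<sigma> \<noteq> 0"
  shows is_SLD_imp_two_level_SLD: "is_SLD a k (transverse \<sigma>) i L \<Longrightarrow>
      two_level.SLD (rho a k (transverse \<sigma>)) (cplx (wave a k 0 \<sigma>)) (cplx (wave a k (pi/2) \<sigma>))
        (cplx (dwave a k 0 (axis i 1) \<sigma>)) (cplx (dwave a k (pi/2) (axis i 1) \<sigma>)) L"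
    and is_SLD_exists: "\<exists>L. is_SLD a k (transverse \<sigma>) i L"
proof -
  interpret two_level "rho a k (transverse \<sigma>)" "cplx (wave a k 0 \<sigma>)" "cplx (wave a k (pi/2) \<sigma>)"
    "cplx (dwave a k 0 (axis i 1) \<sigma>)" "cplx (dwave a k (pi/2) (axis i 1) \<sigma>)"
    using assms by (rule two_level_rho)
  have deriv: "has_oper_derivative (\<lambda>x. rho a k (transverse \<sigma> + x *\<^sub>R transverse (axis i 1))) D"
    if "\<And>f. f \<in> L2 \<Longrightarrow> D f = tangent f" for D
    using that assms(1) by (intro rho_has_oper_derivative) (auto simp: tangent_def)
  show "\<exists>L. is_SLD a k (transverse \<sigma>) i L"
  proof -
    obtain L where "bounded_oper L" "selfadjoint_oper L"
      "\<forall>f\<in>L2. (\<lambda>r. 1/2 * (L (rho a k (transverse \<sigma>) f) r + rho a k (transverse \<sigma>) (L f) r)) = tangent f"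
      using SLD_exists by blast
    then have "is_SLD a k (transverse \<sigma>) i L"
      unfolding is_SLD_def by (intro conjI deriv) auto
    then show ?thesis by blast
  qed
  assume L: "is_SLD a k (transverse \<sigma>) i L"
  then have bL: "bounded_oper L" by (simp add: is_SLD_def)
  have "AE r in lborel. 1/2 * (L (rho a k (transverse \<sigma>) f) r + rho a k (transverse \<sigma>) (L f) r) = tangent f r"
    if f: "f \<in> L2" for f
  proof (rule has_oper_derivative_unique_AE[OF _ deriv[of tangent] f])
    show "has_oper_derivative (\<lambda>x. rho a k (transverse \<sigma> + x *\<^sub>R transverse (axis i 1)))
       (\<lambda>f r. 1/2 * (L (rho a k (transverse \<sigma>) f) r + rho a k (transverse \<sigma>) (L f) r))"
      using L by (simp only: is_SLD_def)
    show "(\<lambda>r. 1/2 * (L (rho a k (transverse \<sigma>) f) r + rho a k (transverse \<sigma>) (L f) r)) \<in> L2"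
      by (intro L2_cmult L2_add L2_R bounded_oper_L2[OF bL] f)
    show "rho a k (transverse \<sigma> + x *\<^sub>R transverse (axis i 1)) f \<in> L2" for x
      unfolding transverse_add_scaleR rho_transverse[OF assms(1) f]
      using assms(1) by (intro L2_add L2_ketbra L2_wave)
  qed (simp_all add: L2_tangent)
  with L show "SLD L" by (simp add: is_SLD_def SLD_def)
qed

lemma info_bound_transverse:
  assumes "a > 0" "k > 0" "\<sigma> \<noteq> 0" and B: "orthonormal_basis B" and \<pi>: "\<pi> \<in> L2"
  shows "info_bound a k (ketbra \<pi> \<pi>) (transverse \<sigma>) $ i $ j =
    Re (4 * (braket \<pi> (cplx (dwave a k 0 (axis j 1) \<sigma>)) * braket (cplx (dwave a k 0 (axis i 1) \<sigma>)) \<pi> +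
      braket \<pi> (cplx (dwave a k (pi/2) (axis j 1) \<sigma>)) * braket (cplx (dwave a k (pi/2) (axis i 1) \<sigma>)) \<pi>))"
    (is "_ = ?x")
proof -
  have val: "Re (oper_trace (rho a k (transverse \<sigma>) \<circ> L \<circ> ketbra \<pi> \<pi> \<circ> L')) = ?x"
    if "is_SLD a k (transverse \<sigma>) i L" "is_SLD a k (transverse \<sigma>) j L'" for L L'
    using oper_trace_SLD[OF B \<pi> two_level_rho[OF assms(1-3)] two_level_rho[OF assms(1-3)]
        is_SLD_imp_two_level_SLD[OF assms(1-3) that(1)] is_SLD_imp_two_level_SLD[OF assms(1-3) that(2)]]
    by simp
  \<comment> \<open>If no such pair existed, every number would satisfy the description and it would
    denote nothing definite.\<close>
  obtain L L' where "is_SLD a k (transverse \<sigma>) i L" "is_SLD a k (transverse \<sigma>) j L'"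
    using is_SLD_exists[OF assms(1-3)] by metis
  then have "(THE x. \<forall>L L'. is_SLD a k (transverse \<sigma>) i L \<longrightarrow> is_SLD a k (transverse \<sigma>) j L' \<longrightarrow>
      x = Re (oper_trace (rho a k (transverse \<sigma>) \<circ> L \<circ> ketbra \<pi> \<pi> \<circ> L'))) = ?x"
    by (intro the_equality) (use val in auto)
  then show ?thesis by (simp add: info_bound_def)
qed

lemma prob_fun_transverse:
  assumes "a > 0" and B: "orthonormal_basis B" and \<pi>: "\<pi> \<in> L2"
  shows "prob_fun a k (ketbra \<pi> \<pi>) (transverse \<sigma>) =
    (cmod (braket \<pi> (cplx (wave a k 0 \<sigma>))))\<^sup>2 + (cmod (braket \<pi> (cplx (wave a k (pi/2) \<sigma>))))\<^sup>2"
proof -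
  let ?C = "cplx (wave a k 0 \<sigma>)" and ?S = "cplx (wave a k (pi/2) \<sigma>)"
  have CS: "?C \<in> L2" "?S \<in> L2" using assms by (auto intro: L2_wave)
  have br: "braket e (rho a k (transverse \<sigma>) f) = braket e ?C * braket ?C f + braket e ?S * braket ?S f"
    if "e \<in> L2" "f \<in> L2" for e f
    unfolding rho_transverse[OF assms(1) that(2)] using that CS
    by (simp add: braket_add_right L2_ketbra braket_ketbra_right)
  have "oper_trace (rho a k (transverse \<sigma>) \<circ> ketbra \<pi> \<pi>) = braket \<pi> (rho a k (transverse \<sigma>) \<pi>)"
  proof (rule oper_trace_rank_one[OF B \<pi>])
    show "rho a k (transverse \<sigma>) \<pi> \<in> L2"
      unfolding rho_transverse[OF assms(1) \<pi>] using CS by (intro L2_add L2_ketbra)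
    fix e assume e: "e \<in> L2"
    then show "braket e ((rho a k (transverse \<sigma>) \<circ> ketbra \<pi> \<pi>) e) =
        braket \<pi> e * braket e (rho a k (transverse \<sigma>) \<pi>)"
      using \<pi> by (simp add: br L2_ketbra braket_ketbra_right algebra_simps)
  qed
  also have "\<dots> = complex_of_real ((cmod (braket \<pi> ?C))\<^sup>2 + (cmod (braket \<pi> ?S))\<^sup>2)"
    using br[OF \<pi> \<pi>] by (simp only: braket_commute[of _ \<pi>] of_real_add complex_norm_square)
  finally show ?thesis by (simp add: prob_fun_def)
qed

text \<open>If the probability is the square of a smooth amplitude \<open>g\<close>, then
  \<open>\<partial>\<^sub>i (g\<^sup>2) \<partial>\<^sub>j (g\<^sup>2) / g\<^sup>2 = 4 \<partial>\<^sub>i g \<partial>\<^sub>j g\<close>, and at a zero of \<open>g\<close> the Hessian of \<open>g\<^sup>2\<close> is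
  \<open>2 \<partial>\<^sub>p g \<partial>\<^sub>q g\<close>, so that a direction with positive second derivative leaves the zero set.\<close>

lemma saturated_if_square:
  fixes g :: "real^2 \<Rightarrow> real" and G :: "real^2 \<Rightarrow> real^2 \<Rightarrow> real"
  assumes h: "\<And>\<sigma>. prob_fun a k P (transverse \<sigma>) = (g \<sigma>)\<^sup>2"
    and I: "\<And>\<sigma> i j. \<sigma> \<noteq> 0 \<Longrightarrow> info_bound a k P (transverse \<sigma>) $ i $ j = 4 * (G (axis i 1) \<sigma> * G (axis j 1) \<sigma>)"
    and g: "\<And>\<sigma> v. ((\<lambda>x. g (\<sigma> + x *\<^sub>R v)) has_real_derivative G v \<sigma>) (at 0)"
    and G: "\<And>\<sigma> v u. \<exists>D. ((\<lambda>x. G v (\<sigma> + x *\<^sub>R u)) has_real_derivative D) (at 0)"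
    and lin: "\<And>\<sigma> v. G v \<sigma> = G (axis 1 1) \<sigma> * v$1 + G (axis 2 1) \<sigma> * v$2"
    and s0: "s0 $ 3 = 0"
  shows "saturated a k P s0"
proof -
  define \<sigma>0 where "\<sigma>0 = (\<chi> i. if i = 1 then s0 $ 1 else s0 $ 2 :: real^2)"
  have s0_eq: "s0 = transverse \<sigma>0" using s0 by (simp add: vec_eq_iff forall_3 \<sigma>0_def)
  have cont: "((\<lambda>x. g (\<sigma>0 + x *\<^sub>R v)) \<longlongrightarrow> g \<sigma>0) (at 0)"
    and contG: "((\<lambda>x. G u (\<sigma>0 + x *\<^sub>R v)) \<longlongrightarrow> G u \<sigma>0) (at 0)" for u v
    using DERIV_isCont[OF g[of \<sigma>0 v]] G[of u \<sigma>0 v] by (auto simp: isCont_def dest!: DERIV_isCont)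
  have part: "partial i (prob_fun a k P) (transverse \<sigma>) = 2 * g \<sigma> * G (axis i 1) \<sigma>" for i \<sigma>
  proof -
    have "((\<lambda>x. (g (\<sigma> + x *\<^sub>R axis i 1))\<^sup>2) has_real_derivative 2 * g \<sigma> * G (axis i 1) \<sigma>) (at 0)"
      by (rule derivative_eq_intros g refl | simp)+
    then show ?thesis by (simp add: partial_def transverse_add_scaleR h DERIV_imp_deriv)
  qed
  have fisher: "fisher_info a k P (transverse \<sigma>) $ i $ j = 4 * (G (axis i 1) \<sigma> * G (axis j 1) \<sigma>)"
    if "g \<sigma> \<noteq> 0" for \<sigma> i j
    using that by (simp add: fisher_info_def part h power2_eq_square)
  have hess: "prob_hessian a k P s0 $ p $ q = 2 * G (axis p 1) \<sigma>0 * G (axis q 1) \<sigma>0"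
    if g0: "g \<sigma>0 = 0" for p q
  proof -
    \<comment> \<open>The value \<open>D\<close> drops out of the product rule, being multiplied by
      the amplitude, which is zero here; the rule still needs the derivative to exist.\<close>
    obtain D where D: "((\<lambda>x. G (axis q 1) (\<sigma>0 + x *\<^sub>R axis p 1)) has_real_derivative D) (at 0)"
      using G by blast
    have "((\<lambda>x. 2 * g (\<sigma>0 + x *\<^sub>R axis p 1) * G (axis q 1) (\<sigma>0 + x *\<^sub>R axis p 1)) has_real_derivative
        2 * G (axis p 1) \<sigma>0 * G (axis q 1) \<sigma>0) (at 0)"
      by (rule derivative_eq_intros g D refl | simp add: g0)+
    then show ?thesis
      unfolding prob_hessian_def s0_eq
      by (simp add: partial_def[of p] transverse_add_scaleR part DERIV_imp_deriv)
  qed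
  define M :: "real^2^2" where "M = (\<chi> i j. 4 * (G (axis i 1) \<sigma>0 * G (axis j 1) \<sigma>0))"
  have limM: "(F \<longlongrightarrow> M) (at 0)"
    if "\<forall>\<^sub>F t in at 0. \<forall>i j. F t $ i $ j = 4 * (G (axis i 1) (\<sigma>0 + t *\<^sub>R v) * G (axis j 1) (\<sigma>0 + t *\<^sub>R v))"
    for F :: "real \<Rightarrow> real^2^2" and v
  proof (intro vec_tendstoI)
    fix i j
    have "((\<lambda>t. 4 * (G (axis i 1) (\<sigma>0 + t *\<^sub>R v) * G (axis j 1) (\<sigma>0 + t *\<^sub>R v))) \<longlongrightarrow> M $ i $ j) (at 0)"
      unfolding M_def by (simp, intro tendsto_intros contG)
    then show "((\<lambda>t. F t $ i $ j) \<longlongrightarrow> M $ i $ j) (at 0)"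
      by (rule Lim_transform_eventually) (use that in \<open>eventually_elim, simp\<close>)
  qed
  have info: "((\<lambda>t. info_bound a k P (s0 + t *\<^sub>R transverse v)) \<longlongrightarrow> M) (at 0)" if "v \<noteq> 0" for v
  proof -
    \<comment> \<open>Near the base point the punctured line misses the origin: through the origin
      because \<open>v\<close> is nonzero, elsewhere by continuity.\<close>
    have "\<forall>\<^sub>F t in at 0. \<sigma>0 + t *\<^sub>R v \<noteq> 0"
    proof (cases "\<sigma>0 = 0")
      case True
      then show ?thesis using that by (simp add: eventually_at_filter)
    next
      case False
      have "((\<lambda>t. \<sigma>0 + t *\<^sub>R v) \<longlongrightarrow> \<sigma>0 + 0 *\<^sub>R v) (at 0)" by (intro tendsto_intros)
      then show ?thesis using False by (intro tendsto_imp_eventually_ne) auto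
    qed
    then show ?thesis
      unfolding s0_eq transverse_add_scaleR by (intro limM[of _ v]) (auto elim!: eventually_mono simp: I)
  qed
  have agree: "limits_agree a k P s0 v" if "v \<noteq> 0" "\<forall>\<^sub>F t in at 0. g (\<sigma>0 + t *\<^sub>R v) \<noteq> 0" for v
  proof -
    have "((\<lambda>t. fisher_info a k P (s0 + t *\<^sub>R transverse v)) \<longlongrightarrow> M) (at 0)"
      unfolding s0_eq transverse_add_scaleR using that(2)
      by (intro limM[of _ v]) (auto elim!: eventually_mono simp: fisher)
    then show ?thesis unfolding limits_agree_def using info[OF that(1)] by blast
  qed
  show ?thesis
  proof (cases "g \<sigma>0 = 0")
    case False
    have "limits_agree a k P s0 v" if "v \<noteq> 0" for v
      using that False cont[of v] by (intro agree tendsto_imp_eventually_ne) auto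
    moreover have "prob_fun a k P s0 > 0" using False by (simp add: s0_eq h)
    ultimately show ?thesis unfolding saturated_def by simp
  next
    case True
    have "limits_agree a k P s0 v"
      if "v \<noteq> 0" and pos: "(\<Sum>p\<in>UNIV. \<Sum>q\<in>UNIV. prob_hessian a k P s0 $ p $ q * v$p * v$q) > 0" for v
    proof -
      \<comment> \<open>The Hessian has rank at most one, so a positive quadratic form means a
        nonzero directional derivative of the amplitude, which makes the zero at the base point
        isolated on the line.\<close>
      have "(\<Sum>p\<in>UNIV. \<Sum>q\<in>UNIV. prob_hessian a k P s0 $ p $ q * v$p * v$q) = 2 * (G v \<sigma>0)\<^sup>2"
        unfolding lin[of v] by (simp add: hess[OF True] sum_2 power2_eq_square algebra_simps)
      then have ne: "G v \<sigma>0 \<noteq> 0" using pos by auto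
      have "((\<lambda>t. (g (\<sigma>0 + t *\<^sub>R v) - g (\<sigma>0 + 0 *\<^sub>R v)) / t) \<longlongrightarrow> G v \<sigma>0) (at 0)"
        using g[of \<sigma>0 v] by (simp add: DERIV_def)
      then have "\<forall>\<^sub>F t in at 0. (g (\<sigma>0 + t *\<^sub>R v) - g (\<sigma>0 + 0 *\<^sub>R v)) / t \<noteq> 0"
        using ne by (rule tendsto_imp_eventually_ne)
      then have "\<forall>\<^sub>F t in at 0. g (\<sigma>0 + t *\<^sub>R v) \<noteq> 0"
        by eventually_elim (simp add: True)
      then show ?thesis using that by (intro agree)
    qed
    moreover have "((\<lambda>t. info_bound a k P (s0 + t *\<^sub>R transverse v)) \<longlongrightarrow> 0) (at 0)"
      if "prob_hessian a k P s0 = 0" "v \<noteq> 0" for v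
    proof -
      \<comment> \<open>Entrywise \<open>M\<close> is twice the Hessian, so both vanish
        together.\<close>
      have "2 * G (axis p 1) \<sigma>0 * G (axis q 1) \<sigma>0 = 0" for p q
        using that hess[OF True, of p q] by simp
      then have "M = 0" by (auto simp: M_def vec_eq_iff)
      then show ?thesis using info[OF that(2)] by simp
    qed
    moreover have "\<not> prob_fun a k P s0 > 0" using True by (simp add: s0_eq h)
    ultimately show ?thesis unfolding saturated_def by simp
  qed
qed

section \<open>Overlaps with a real basis function of definite parity\<close>

theorem mainTheorem14:
  fixes a k :: real and B :: "wavefun set"
  assumes "a > 0" and "k > 0"
    and "orthonormal_basis B"
    and "\<And>\<pi>. \<pi> \<in> B \<Longrightarrow> AE r in lborel. \<pi> r \<in> \<real>"
    and "\<And>\<pi>. \<pi> \<in> B \<Longrightarrow>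
           (AE r in lborel. \<pi> (- r) = \<pi> r) \<or> (AE r in lborel. \<pi> (- r) = - \<pi> r)"
  shows "\<forall>s0 :: real^3. s0 $ 3 = 0 \<longrightarrow> (\<forall>\<pi>\<in>B. saturated a k (ketbra \<pi> \<pi>) s0)"
proof (intro allI impI ballI)
  fix s0 :: "real^3" and \<pi> assume s0: "s0 $ 3 = 0" and \<pi>B: "\<pi> \<in> B"
  have \<pi>: "\<pi> \<in> L2" using assms(3) \<pi>B by (auto simp: orthonormal_basis_def)
  \<comment> \<open>\<open>\<pi>\<close> is real only almost everywhere; \<open>p\<close> is a
    representative that is real everywhere, with the same brackets.\<close>
  define p where "p = (\<lambda>r. Re (\<pi> r))"
  have [measurable]: "\<pi> \<in> borel_measurable borel" using L2_measurable[OF \<pi>] by simp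
  have pm [measurable]: "p \<in> borel_measurable borel" unfolding p_def by measurable
  have \<pi>_eq: "AE r in lborel. \<pi> r = cplx p r"
    using assms(4)[OF \<pi>B] by eventually_elim (simp add: p_def)
  have p2: "cplx p \<in> L2"
  proof -
    have "integrable lborel (\<lambda>r. (cmod (cplx p r))\<^sup>2)"
      by (rule Bochner_Integration.integrable_bound[OF L2_integrable_square[OF \<pi>]])
        (auto simp: p_def cmod_power2)
    then show ?thesis by (simp add: L2_def)
  qed
  \<comment> \<open>This family is closed under differentiation in \<open>\<sigma>\<close>: each
    derivative multiplies the weight by \<open>k * (v \<bullet> r)\<close> and lowers the phase by
    \<open>pi/2\<close>. A single derivative rule thus covers the amplitude and its
    gradient.\<close>
  define J where "J w \<phi> \<sigma> = (LINT r|lborel. w r * cos (k * (\<sigma> \<bullet> r) - \<phi>))"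
    for w :: "real^2 \<Rightarrow> real" and \<phi> \<sigma>
  define w where "w r = p r * aperture a r" for r
  define dw where "dw v r = w r * (k * (v \<bullet> r))" for v r
  have w_int: "integrable lborel w"
    using integrable_cnj_mult[OF p2 L2_aperture[OF assms(1)]]
    by (auto simp: w_def[abs_def] complex_of_real_integrable_eq simp flip: of_real_mult)
  have w_supp: "w r = 0" if "norm r > a" for r using aperture_eq_0[OF assms(1) that] by (simp add: w_def)
  have [measurable]: "w \<in> borel_measurable borel" unfolding w_def[abs_def] by measurable
  have dw_int: "integrable lborel (dw v)" for v
  proof (rule Bochner_Integration.integrable_bound)
    show "integrable lborel (\<lambda>r. tilt_bound a k v * w r)" using w_int by simp
    have "\<bar>w r\<bar> * \<bar>k * (v \<bullet> r)\<bar> \<le> \<bar>w r\<bar> * tilt_bound a k v" for r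
      using tilt_le[of r a k v] w_supp[of r] by (cases "norm r \<le> a") (auto intro: mult_left_mono)
    then show "AE r in lborel. norm (dw v r) \<le> norm (tilt_bound a k v * w r)"
      using assms(1) by (simp add: dw_def abs_mult tilt_bound_def mult_ac)
  qed (simp add: dw_def[abs_def])
  have dw_supp: "dw v r = 0" if "norm r > a" for v r using w_supp[OF that] by (simp add: dw_def)
  have cos_shift: "cos (y - (\<phi> - pi/2)) = - sin (y - \<phi>)" for y \<phi> :: real
    using cos_add[of "y - \<phi>" "pi/2"] by (simp add: algebra_simps)
  have J_deriv: "((\<lambda>x. J u \<phi> (\<sigma> + x *\<^sub>R v)) has_real_derivative
      J (\<lambda>r. u r * (k * (v \<bullet> r))) (\<phi> - pi/2) \<sigma>) (at 0)"
    if "integrable lborel u" "\<And>r. norm r > a \<Longrightarrow> u r = 0" for u \<phi> \<sigma> v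
  proof -
    show ?thesis
      unfolding J_def
      using cos_integral_has_derivative[OF that, where k = k and \<sigma> = \<sigma> and v = v and \<phi> = \<phi>]
      by (simp add: cos_shift)
  qed
  have br: "braket \<pi> (cplx (wave a k \<phi> \<sigma>)) = complex_of_real (J w \<phi> \<sigma>)"
    and dbr: "braket \<pi> (cplx (dwave a k \<phi> v \<sigma>)) = complex_of_real (J (dw v) (\<phi> - pi/2) \<sigma>)" for \<phi> v \<sigma>
  proof -
    have "braket \<pi> (cplx (wave a k \<phi> \<sigma>)) = braket (cplx p) (cplx (wave a k \<phi> \<sigma>))"
      using \<pi> p2 \<pi>_eq L2_wave[OF assms(1)] by (intro braket_cong_AE) auto
    then show "braket \<pi> (cplx (wave a k \<phi> \<sigma>)) = complex_of_real (J w \<phi> \<sigma>)"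
      by (simp only: braket_cplx J_def w_def wave_def mult.assoc)
    have "braket \<pi> (cplx (dwave a k \<phi> v \<sigma>)) = braket (cplx p) (cplx (dwave a k \<phi> v \<sigma>))"
      using \<pi> p2 \<pi>_eq L2_dwave[OF assms(1)] by (intro braket_cong_AE) auto
    then show "braket \<pi> (cplx (dwave a k \<phi> v \<sigma>)) = complex_of_real (J (dw v) (\<phi> - pi/2) \<sigma>)"
      by (simp only: braket_cplx J_def dw_def w_def dwave_def cos_shift mult.assoc)
  qed
  \<comment> \<open>\<open>\<phi>\<close> is the phase of the level that shares the parity of
    \<open>\<pi>\<close>, and \<open>\<psi>\<close> that of the other level, whose amplitude and
    derivatives are orthogonal to \<open>\<pi>\<close>. Variable phases treat even and odd basis
    functions at once.\<close>
  have sat: "saturated a k (ketbra \<pi> \<pi>) s0"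
    if \<phi>: "\<phi> = 0 \<and> \<psi> = pi/2 \<or> \<phi> = pi/2 \<and> \<psi> = 0"
      and parity: "\<And>f. f \<in> borel_measurable borel \<Longrightarrow> cplx f \<in> L2 \<Longrightarrow>
        (\<And>r. f (- r) = (if \<psi> = 0 then f r else - f r)) \<Longrightarrow> braket \<pi> (cplx f) = 0" for \<phi> \<psi>
  proof (rule saturated_if_square[where g = "J w \<phi>" and G = "\<lambda>v. J (dw v) (\<phi> - pi/2)", OF _ _ _ _ _ s0])
    have van: "braket \<pi> (cplx (wave a k \<psi> \<sigma>)) = 0" "braket \<pi> (cplx (dwave a k \<psi> v \<sigma>)) = 0" for v \<sigma>
      using \<phi> assms(1)
      by (intro parity; (elim disjE conjE)?; (hypsubst)?; simp add: wave_uminus L2_wave L2_dwave)+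
    fix \<sigma> v u :: "real^2" and i j :: 2
    show "prob_fun a k (ketbra \<pi> \<pi>) (transverse \<sigma>) = (J w \<phi> \<sigma>)\<^sup>2"
      using \<phi> van[of \<sigma>] unfolding prob_fun_transverse[OF assms(1,3) \<pi>]
      by (elim disjE conjE; hypsubst; simp add: br)
    have comm: "braket (cplx f) \<pi> = cnj (braket \<pi> (cplx f))" for f by (rule braket_commute)
    show "info_bound a k (ketbra \<pi> \<pi>) (transverse \<sigma>) $ i $ j =
        4 * (J (dw (axis i 1)) (\<phi> - pi/2) \<sigma> * J (dw (axis j 1)) (\<phi> - pi/2) \<sigma>)" if "\<sigma> \<noteq> 0"
      using \<phi> van(2)[of _ \<sigma>] unfolding info_bound_transverse[OF assms(1,2) that assms(3) \<pi>] comm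
      by (elim disjE conjE; hypsubst; simp add: dbr)
    show "((\<lambda>x. J w \<phi> (\<sigma> + x *\<^sub>R v)) has_real_derivative J (dw v) (\<phi> - pi/2) \<sigma>) (at 0)"
      using J_deriv[OF w_int w_supp] by (simp add: dw_def[abs_def])
    show "\<exists>D. ((\<lambda>x. J (dw v) (\<phi> - pi/2) (\<sigma> + x *\<^sub>R u)) has_real_derivative D) (at 0)"
      using J_deriv[OF dw_int dw_supp] by blast
    have int: "integrable lborel (\<lambda>r. dw v r * cos (k * (\<sigma> \<bullet> r) - (\<phi> - pi/2)))" for v
      by (rule Bochner_Integration.integrable_bound[OF dw_int[of v]])
        (auto simp: dw_def abs_mult mult_left_le)
    \<comment> \<open>The direction enters only through the weight, which is linear in
      \<open>v\<close>.\<close>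
    have "J (dw v) (\<phi> - pi/2) \<sigma> = (LINT r|lborel.
        dw (axis 1 1) r * cos (k * (\<sigma> \<bullet> r) - (\<phi> - pi/2)) * v$1 +
        dw (axis 2 1) r * cos (k * (\<sigma> \<bullet> r) - (\<phi> - pi/2)) * v$2)"
      unfolding J_def
      by (intro Bochner_Integration.integral_cong) (simp_all add: dw_def inner_vec_def sum_2 axis_def algebra_simps)
    also have "\<dots> = J (dw (axis 1 1)) (\<phi> - pi/2) \<sigma> * v$1 + J (dw (axis 2 1)) (\<phi> - pi/2) \<sigma> * v$2"
      unfolding J_def using int by simp
    finally show "J (dw v) (\<phi> - pi/2) \<sigma> =
        J (dw (axis 1 1)) (\<phi> - pi/2) \<sigma> * v$1 + J (dw (axis 2 1)) (\<phi> - pi/2) \<sigma> * v$2" .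
  qed
  have vanish: "braket \<pi> (cplx f) = 0"
    if "f \<in> borel_measurable borel" "cplx f \<in> L2" "AE r in lborel. p (- r) * f (- r) = - (p r * f r)" for f
  proof -
    have "braket \<pi> (cplx f) = braket (cplx p) (cplx f)"
      using \<pi> p2 \<pi>_eq that by (intro braket_cong_AE) auto
    also have "\<dots> = 0" using that by (intro braket_cplx_odd) auto
    finally show ?thesis .
  qed
  from assms(5)[OF \<pi>B] show "saturated a k (ketbra \<pi> \<pi>) s0"
  proof
    assume even: "AE r in lborel. \<pi> (- r) = \<pi> r"
    show ?thesis
    proof (rule sat[of 0 "pi/2"])
      fix f assume "f \<in> borel_measurable borel" "cplx f \<in> L2"
        "\<And>r. f (- r) = (if pi/2 = 0 then f r else - f r)"
      with even show "braket \<pi> (cplx f) = 0"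
        by (intro vanish) (auto elim!: eventually_mono simp: p_def)
    qed auto
  next
    assume odd: "AE r in lborel. \<pi> (- r) = - \<pi> r"
    show ?thesis
    proof (rule sat[of "pi/2" 0])
      fix f assume "f \<in> borel_measurable borel" "cplx f \<in> L2"
        "\<And>r. f (- r) = (if 0 = (0::real) then f r else - f r)"
      with odd show "braket \<pi> (cplx f) = 0"
        by (intro vanish) (auto elim!: eventually_mono simp: p_def)
    qed auto
  qed
qed

end
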